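(* Consider the rate-unconstrained multi-agent contextual bandit setting described in the context, in which the decision-maker runs Thompson Sampling (one independent Bayesian multi-armed bandit per context), samples the arms of all $N$ agents in a round from the current Thompson Sampling policy, and updates the posteriors only at the end of each round. Let $T = J N$ be the total number of arm pulls (virtual rounds). Then the finite-time Bayesian system regret of Thompson Sampling satisfies $$\mathrm{BR}(\pi^{TS}, T) \leq 2SKN + 4\sqrt{(2 + 6\log T)\, S K N T},$$ and the asymptotic regret satisfies $\mathrm{BR}(\pi^{TS}, T) \in \mathcal{O}\big(\sqrt{K S T \log T}\big)$.
   Context: Setting: $\mathcal{S}$ is a finite set of $S=|\mathcal{S}|$ contexts with distribution $P_S$, $P_S(s)>0$ for all $s$; $\mathcal{A}=\{1,\dots,K\}$ is the set of arms. For each pair $(s,a)$, pulling arm $a$ in context $s$ yields a random reward $R(s,a)\in[0,1]$ drawn from an unknown stationary distribution $P_R(\cdot\mid s,a)$ belonging to an exponential family $P_R(r\mid\theta)=b(r)\exp(\eta(\theta)T(r)-A(\theta))$ with $\theta=(s,a)$, known $b,T,A$ and $A$ twice differentiable; $\mu(s,a)=\mathbb{E}[R(s,a)]$ and $a^*(s)\in\arg\max_a \mu(s,a)$. There are $N$ agents solving the same problem instance; in each round $j=1,\dots,J$ each agent $n$ receives an independent context $s_{j,n}\sim P_S$, observed by a central decision-maker, which chooses an arm $A_{j,n}$ for every agent; the policy can only be updated at the end of each round after all $N$ rewards are observed. Thompson Sampling: for each $(s,a)$ the decision-maker maintains a posterior $p_j^{s,a}$ on $\mu(s,a)$; for an agent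 with context $s$ it samples $\hat\mu(s,a)\sim p_j^{s,a}$ independently for all $a$ and plays $\arg\max_a\hat\mu(s,a)$; posteriors are updated by Bayes' rule at the end of each round. The Bayesian system regret is $\mathrm{BR}=\mathbb{E}\big[\sum_{j=1}^J\sum_{n=1}^N \mu(s_{j,n},a^*(s_{j,n}))-\mu(s_{j,n},A_{j,n})\big]$, with expectation over contexts, arm choices and the prior over problem instances; written as a function of $T=JN$. *)

theory Defs
  imports "HOL-Probability.Probability" "HOL-Library.Landau_Symbols"
begin

text \<open>Multi-agent contextual bandit, Thompson Sampling with per-round (batched) posterior updates.
 An observation is (context, arm, reward). A history is a function nat => observation, where
 entry k = j*N + n holds the observation of agent n in round j (0-based rounds/agents).
 Each pair (s,a) has an unknown real parameter theta(s,a); the reward distribution is the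
 exponential family density b r * exp (eta theta * T r - A theta) w.r.t. a base measure nu.\<close>

type_synonym 's obs = "'s \<times> nat \<times> real"

definition obsM :: "'s obs measure" where
  "obsM = count_space UNIV \<Otimes>\<^sub>M (count_space UNIV \<Otimes>\<^sub>M borel)"

definition histM :: "(nat \<Rightarrow> 's obs) measure" where
  "histM = PiM UNIV (\<lambda>_. obsM)"

definition ef_dist :: "real measure \<Rightarrow> (real \<Rightarrow> real) \<Rightarrow> (real \<Rightarrow> real) \<Rightarrow> (real \<Rightarrow> real)
    \<Rightarrow> (real \<Rightarrow> real) \<Rightarrow> real \<Rightarrow> real measure" where
  "ef_dist \<nu> b Tf \<eta> A v = density \<nu> (\<lambda>r. ennreal (b r * exp (\<eta> v * Tf r - A v)))"

definition ef_mean :: "real measure \<Rightarrow> (real \<Rightarrow> real) \<Rightarrow> (real \<Rightarrow> real) \<Rightarrow> (real \<Rightarrow> real)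
    \<Rightarrow> (real \<Rightarrow> real) \<Rightarrow> real \<Rightarrow> real" where
  "ef_mean \<nu> b Tf \<eta> A v = (\<integral>r. r \<partial>ef_dist \<nu> b Tf \<eta> A v)"

definition pulls :: "nat \<Rightarrow> (nat \<Rightarrow> 's obs) \<Rightarrow> 's \<Rightarrow> nat \<Rightarrow> nat set" where
  "pulls m h s a = {k. k < m \<and> fst (h k) = s \<and> fst (snd (h k)) = a}"

definition likelihood :: "(real \<Rightarrow> real) \<Rightarrow> (real \<Rightarrow> real) \<Rightarrow> (real \<Rightarrow> real) \<Rightarrow> (real \<Rightarrow> real)
    \<Rightarrow> nat \<Rightarrow> (nat \<Rightarrow> 's obs) \<Rightarrow> 's \<Rightarrow> nat \<Rightarrow> real \<Rightarrow> real" where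
  "likelihood b Tf \<eta> A m h s a v =
     (\<Prod>k\<in>pulls m h s a. b (snd (snd (h k))) * exp (\<eta> v * Tf (snd (snd (h k))) - A v))"

definition posterior :: "('s \<Rightarrow> nat \<Rightarrow> real measure) \<Rightarrow> (real \<Rightarrow> real) \<Rightarrow> (real \<Rightarrow> real)
    \<Rightarrow> (real \<Rightarrow> real) \<Rightarrow> (real \<Rightarrow> real) \<Rightarrow> nat \<Rightarrow> (nat \<Rightarrow> 's obs) \<Rightarrow> 's \<Rightarrow> nat \<Rightarrow> real measure" where
  "posterior Q b Tf \<eta> A m h s a =
     density (Q s a) (\<lambda>v. ennreal (likelihood b Tf \<eta> A m h s a v) /
                          (\<integral>\<^sup>+u. ennreal (likelihood b Tf \<eta> A m h s a u) \<partial>Q s a))"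

definition greedy :: "nat \<Rightarrow> (nat \<Rightarrow> real) \<Rightarrow> nat" where
  "greedy K f = (LEAST a. a \<in> {1..K} \<and> (\<forall>c\<in>{1..K}. f c \<le> f a))"

definition ts_agent :: "'s pmf \<Rightarrow> nat \<Rightarrow> real measure \<Rightarrow> (real \<Rightarrow> real) \<Rightarrow> (real \<Rightarrow> real)
    \<Rightarrow> (real \<Rightarrow> real) \<Rightarrow> (real \<Rightarrow> real) \<Rightarrow> ('s \<Rightarrow> nat \<Rightarrow> real measure)
    \<Rightarrow> ('s \<times> nat \<Rightarrow> real) \<Rightarrow> nat \<Rightarrow> (nat \<Rightarrow> 's obs) \<Rightarrow> 's obs measure" where
  "ts_agent PS K \<nu> b Tf \<eta> A Q \<theta> m h =
     measure_pmf PS \<bind> (\<lambda>s.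
     PiM {1..K} (\<lambda>a. posterior Q b Tf \<eta> A m h s a) \<bind> (\<lambda>w.
     (let a = greedy K (\<lambda>c. ef_mean \<nu> b Tf \<eta> A (w c)) in
      distr (ef_dist \<nu> b Tf \<eta> A (\<theta> (s, a))) obsM (\<lambda>r. (s, a, r)))))"

definition ts_round :: "'s pmf \<Rightarrow> nat \<Rightarrow> nat \<Rightarrow> real measure \<Rightarrow> (real \<Rightarrow> real) \<Rightarrow> (real \<Rightarrow> real)
    \<Rightarrow> (real \<Rightarrow> real) \<Rightarrow> (real \<Rightarrow> real) \<Rightarrow> ('s \<Rightarrow> nat \<Rightarrow> real measure)
    \<Rightarrow> ('s \<times> nat \<Rightarrow> real) \<Rightarrow> nat \<Rightarrow> (nat \<Rightarrow> 's obs) \<Rightarrow> (nat \<Rightarrow> 's obs) measure" where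
  "ts_round PS K N \<nu> b Tf \<eta> A Q \<theta> j h =
     distr (PiM {..<N} (\<lambda>n. ts_agent PS K \<nu> b Tf \<eta> A Q \<theta> (j * N) h)) histM
       (\<lambda>ob k. if j * N \<le> k \<and> k < Suc j * N then ob (k - j * N) else h k)"

primrec ts_run :: "'s pmf \<Rightarrow> nat \<Rightarrow> nat \<Rightarrow> real measure \<Rightarrow> (real \<Rightarrow> real) \<Rightarrow> (real \<Rightarrow> real)
    \<Rightarrow> (real \<Rightarrow> real) \<Rightarrow> (real \<Rightarrow> real) \<Rightarrow> ('s \<Rightarrow> nat \<Rightarrow> real measure)
    \<Rightarrow> ('s \<times> nat \<Rightarrow> real) \<Rightarrow> nat \<Rightarrow> (nat \<Rightarrow> 's obs) measure" where
  "ts_run PS K N \<nu> b Tf \<eta> A Q \<theta> 0 = return histM (\<lambda>_. undefined)"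
| "ts_run PS K N \<nu> b Tf \<eta> A Q \<theta> (Suc j) =
     ts_run PS K N \<nu> b Tf \<eta> A Q \<theta> j \<bind> ts_round PS K N \<nu> b Tf \<eta> A Q \<theta> j"

definition sys_regret :: "nat \<Rightarrow> real measure \<Rightarrow> (real \<Rightarrow> real) \<Rightarrow> (real \<Rightarrow> real) \<Rightarrow> (real \<Rightarrow> real)
    \<Rightarrow> (real \<Rightarrow> real) \<Rightarrow> ('s \<times> nat \<Rightarrow> real) \<Rightarrow> nat \<Rightarrow> (nat \<Rightarrow> 's obs) \<Rightarrow> real" where
  "sys_regret K \<nu> b Tf \<eta> A \<theta> n h =
     (\<Sum>k<n. (MAX c\<in>{1..K}. ef_mean \<nu> b Tf \<eta> A (\<theta> (fst (h k), c)))
             - ef_mean \<nu> b Tf \<eta> A (\<theta> (fst (h k), fst (snd (h k)))))"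

definition instance_prior :: "nat \<Rightarrow> ('s \<Rightarrow> nat \<Rightarrow> real measure) \<Rightarrow> ('s \<times> nat \<Rightarrow> real) measure" where
  "instance_prior K Q = PiM (UNIV \<times> {1..K}) (\<lambda>(s, a). Q s a)"

definition bayes_regret_TS :: "'s pmf \<Rightarrow> nat \<Rightarrow> nat \<Rightarrow> real measure \<Rightarrow> (real \<Rightarrow> real) \<Rightarrow> (real \<Rightarrow> real)
    \<Rightarrow> (real \<Rightarrow> real) \<Rightarrow> (real \<Rightarrow> real) \<Rightarrow> ('s \<Rightarrow> nat \<Rightarrow> real measure) \<Rightarrow> nat \<Rightarrow> real" where
  "bayes_regret_TS PS K N \<nu> b Tf \<eta> A Q J =
     (\<integral>\<theta>. (\<integral>h. sys_regret K \<nu> b Tf \<eta> A \<theta> (J * N) h \<partial>ts_run PS K N \<nu> b Tf \<eta> A Q \<theta> J)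
        \<partial>instance_prior K Q)"

end

(* Russo and Van Roy's argument. Given the history, the instance is distributed according to the
   posterior, so the sampled arm and the optimal arm have the same conditional law. Hence every
   history-dependent upper confidence bound has the same expectation at both, and the regret of
   a round is at most the expected confidence width plus the probability that some empirical
   mean leaves its confidence interval. The latter is controlled by the exponential
   supermartingale of Hoeffding's lemma. A posterior that lags behind by less than N pulls costs
   2N pulls per arm and otherwise at most a factor sqrt 2 in the widths, whose sum is bounded by
   Cauchy-Schwarz. *)
theory Submission
  imports Defs
begin

section \<open>Product kernels and elementary facts\<close>

text \<open>Conditioning on the history is done by a change of measure. Give every pair the same
  parameter \<open>v0\<close>: the run on this reference instance dominates the run on any instance
  with parameters in \<open>\<Theta>\<close>, with the likelihood ratio as density, because contexts
  and arms are drawn from the history alone. Instance and history thus have a joint density on a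
  product measure, and Bayes' rule becomes Fubini's theorem. The posterior is a probability measure
  only where the evidence is positive and finite; as all members of the family have the same
  support, this holds almost surely under each such instance. Expectations are taken in
  \<open>ennreal\<close>, so the regret decomposition is stated additively and its finite common
  part is cancelled at the end. The confidence parameter is sqrt (ln T): the confidence intervals at
  a round start fail with probability at most 2SK/T, charged twice for each of T pulls, hence a
  summand 4SK. If SK \<le> T, it fits into the gap between sqrt (2 ln T) and sqrt (2 + 6 ln T);
  otherwise the trivial bound T is below 2SKN.\<close>

lemma PiM_cong_sigma_finite:
  assumes "\<And>i. i \<in> I \<Longrightarrow> sigma_finite_measure (M i)"
  obtains M' where "PiM I M = PiM I M'" "product_sigma_finite M'" "\<And>i. i \<in> I \<Longrightarrow> M' i = M i"
proof
  \<comment> \<open>The locale \<open>product_sigma_finite\<close> constrains every index of the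
    type, so the indices outside \<open>I\<close> receive the measure on the empty space;
    \<open>PiM I\<close> does not see them.\<close>
  let ?M' = "\<lambda>i. if i \<in> I then M i else count_space {}"
  show "PiM I M = PiM I ?M'" by (rule PiM_cong) auto
  show "product_sigma_finite ?M'"
    unfolding product_sigma_finite_def
    using assms by (auto intro: sigma_finite_measure_count_space_finite)
qed auto

lemma emeasure_PiM_finite:
  assumes "finite I" "\<And>i. i \<in> I \<Longrightarrow> sigma_finite_measure (M i)" "\<And>i. i \<in> I \<Longrightarrow> X i \<in> sets (M i)"
  shows "emeasure (PiM I M) (Pi\<^sub>E I X) = (\<Prod>i\<in>I. emeasure (M i) (X i))"
proof -
  obtain M' where M': "PiM I M = PiM I M'" "product_sigma_finite M'" "\<And>i. i \<in> I \<Longrightarrow> M' i = M i"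
    using PiM_cong_sigma_finite[of I M] assms(2) by blast
  interpret product_sigma_finite M' by fact
  show ?thesis using assms M' by (simp add: emeasure_PiM)
qed

lemma nn_integral_PiM_prod:
  assumes "finite I" "\<And>i. i \<in> I \<Longrightarrow> sigma_finite_measure (M i)"
    "\<And>i. i \<in> I \<Longrightarrow> f i \<in> borel_measurable (M i)"
  shows "(\<integral>\<^sup>+x. (\<Prod>i\<in>I. f i (x i)) \<partial>PiM I M) = (\<Prod>i\<in>I. \<integral>\<^sup>+x. f i x \<partial>M i)"
proof -
  obtain M' where M': "PiM I M = PiM I M'" "product_sigma_finite M'" "\<And>i. i \<in> I \<Longrightarrow> M' i = M i"
    using PiM_cong_sigma_finite[of I M] assms(2) by blast
  interpret product_sigma_finite M' by fact
  show ?thesis using assms M' by (simp add: product_nn_integral_prod)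
qed

text \<open>Both sides agree on boxes, where the integral factorises, and boxes determine a finite
  product of sigma-finite measures. It serves for the N agents of a round and for the posteriors of
  all context-arm pairs.\<close>

lemma PiM_density:
  assumes fin: "finite I" and sf: "\<And>i. i \<in> I \<Longrightarrow> sigma_finite_measure (M i)"
    and f[measurable]: "\<And>i. i \<in> I \<Longrightarrow> f i \<in> borel_measurable (M i)"
    and sfd: "\<And>i. i \<in> I \<Longrightarrow> sigma_finite_measure (density (M i) (f i))"
  shows "PiM I (\<lambda>i. density (M i) (f i)) = density (PiM I M) (\<lambda>x. \<Prod>i\<in>I. f i (x i))"
proof -
  let ?D = "\<lambda>i. density (M i) (f i)"
  obtain D' where D': "PiM I ?D = PiM I D'" "product_sigma_finite D'" "\<And>i. i \<in> I \<Longrightarrow> D' i = ?D i"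
    using PiM_cong_sigma_finite[of I ?D] sfd by blast
  interpret product_sigma_finite D' by fact
  have sets: "sets (PiM I M) = sets (PiM I D')"
    by (rule sets_PiM_cong) (auto simp: D'(3))
  have "density (PiM I M) (\<lambda>x. \<Prod>i\<in>I. f i (x i)) = PiM I D'"
  proof (rule PiM_eqI[OF fin])
    show "sets (density (PiM I M) (\<lambda>x. \<Prod>i\<in>I. f i (x i))) = sets (PiM I D')" by (simp add: sets)
  next
    fix X assume X: "\<And>i. i \<in> I \<Longrightarrow> X i \<in> sets (D' i)"
    hence X': "\<And>i. i \<in> I \<Longrightarrow> X i \<in> sets (M i)" by (simp add: D'(3))
    have "emeasure (density (PiM I M) (\<lambda>x. \<Prod>i\<in>I. f i (x i))) (Pi\<^sub>E I X) =
        (\<integral>\<^sup>+x. (\<Prod>i\<in>I. f i (x i)) * indicator (Pi\<^sub>E I X) x \<partial>PiM I M)"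
      using X' fin by (subst emeasure_density) (auto intro!: sets_PiM_I_finite borel_measurable_prod_ennreal
           measurable_compose[OF measurable_component_singleton])
    also have "\<dots> = (\<integral>\<^sup>+x. (\<Prod>i\<in>I. f i (x i) * indicator (X i) (x i)) \<partial>PiM I M)"
    proof (rule nn_integral_cong)
      fix x assume x: "x \<in> space (PiM I M)"
      have "(indicator (Pi\<^sub>E I X) x :: ennreal) = (\<Prod>i\<in>I. indicator (X i) (x i))"
      proof (cases "x \<in> Pi\<^sub>E I X")
        case True
        then show ?thesis by (auto simp: PiE_iff)
      next
        case False
        then obtain i where "i \<in> I" "x i \<notin> X i" using x by (auto simp: space_PiM PiE_iff)
        then have "(\<Prod>i\<in>I. indicator (X i) (x i) :: ennreal) = 0" using fin by (auto intro!: prod_zero bexI[of _ i])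
        with False show ?thesis by simp
      qed
      then show "(\<Prod>i\<in>I. f i (x i)) * indicator (Pi\<^sub>E I X) x = (\<Prod>i\<in>I. f i (x i) * indicator (X i) (x i))"
        by (simp add: prod.distrib)
    qed
    also have "\<dots> = (\<Prod>i\<in>I. \<integral>\<^sup>+y. f i y * indicator (X i) y \<partial>M i)"
      using X' by (intro nn_integral_PiM_prod fin sf) auto
    also have "\<dots> = (\<Prod>i\<in>I. emeasure (D' i) (X i))"
      using X' by (intro prod.cong refl) (simp add: D'(3) emeasure_density)
    finally show "emeasure (density (PiM I M) (\<lambda>x. \<Prod>i\<in>I. f i (x i))) (Pi\<^sub>E I X) =
      (\<Prod>i\<in>I. emeasure (D' i) (X i))" .
  qed
  then show ?thesis by (simp add: D'(1))
qed

text \<open>Boxes are an intersection-stable generator, and on a box the product measure is a finite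
  product of measurable functions of the parameter. The posterior sample of an agent and the
  observations of a round become kernels this way.\<close>

lemma measurable_PiM_kernel:
  assumes fin: "finite I" and M: "\<And>i. i \<in> I \<Longrightarrow> (\<lambda>x. M x i) \<in> L \<rightarrow>\<^sub>M subprob_algebra (N i)"
  shows "(\<lambda>x. PiM I (M x)) \<in> L \<rightarrow>\<^sub>M subprob_algebra (PiM I N)"
proof -
  have sp: "subprob_space (M x i)" and st: "sets (M x i) = sets (N i)" if "x \<in> space L" "i \<in> I" for x i
    by (rule subprob_space_kernel[OF M[OF that(2)] that(1)]) (rule sets_kernel[OF M[OF that(2)] that(1)])
  have sf: "sigma_finite_measure (M x i)" if "x \<in> space L" "i \<in> I" for x i
  proof -
    interpret subprob_space "M x i" using sp[OF that] .
    show ?thesis ..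
  qed
  have sets: "sets (PiM I (M x)) = sets (PiM I N)" if "x \<in> space L" for x
    by (rule sets_PiM_cong) (auto simp: st that)
  have em: "(\<lambda>x. emeasure (PiM I (M x)) (Pi\<^sub>E I X)) \<in> borel_measurable L"
    if X: "\<And>i. i \<in> I \<Longrightarrow> X i \<in> sets (N i)" for X
  proof -
    have "(\<lambda>x. \<Prod>i\<in>I. emeasure (M x i) (X i)) \<in> borel_measurable L"
      using X by (intro borel_measurable_prod_ennreal measurable_emeasure_kernel[OF M]) auto
    moreover have "emeasure (PiM I (M x)) (Pi\<^sub>E I X) = (\<Prod>i\<in>I. emeasure (M x i) (X i))"
      if "x \<in> space L" for x
      using X that by (intro emeasure_PiM_finite fin sf) (auto simp: st)
    ultimately show ?thesis by (subst measurable_cong) auto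
  qed
  show ?thesis
  proof (rule measurable_subprob_algebra_generated[OF _ Int_stable_prod_algebra prod_algebra_sets_into_space])
    show "sets (PiM I N) = sigma_sets (\<Pi>\<^sub>E i\<in>I. space (N i)) (prod_algebra I N)" by (rule sets_PiM)
    show "sets (PiM I (M x)) = sets (PiM I N)" if "x \<in> space L" for x using sets[OF that] .
    show "(\<lambda>a. emeasure (PiM I (M a)) X) \<in> borel_measurable L" if "X \<in> prod_algebra I N" for X
      using that em by (auto simp: prod_algebra_eq_finite[OF fin])
    show "(\<lambda>a. emeasure (PiM I (M a)) (\<Pi>\<^sub>E i\<in>I. space (N i))) \<in> borel_measurable L"
      by (rule em) auto
    show "subprob_space (PiM I (M x))" if x: "x \<in> space L" for x
    proof
      have "emeasure (PiM I (M x)) (space (PiM I (M x))) = (\<Prod>i\<in>I. emeasure (M x i) (space (M x i)))"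
        unfolding space_PiM using x by (intro emeasure_PiM_finite fin sf) auto
      also have "\<dots> \<le> (\<Prod>i\<in>I. 1)"
        by (intro prod_mono_ennreal subprob_space.emeasure_space_le_1 sp x)
      finally show "emeasure (PiM I (M x)) (space (PiM I (M x))) \<le> 1" by simp
      show "space (PiM I (M x)) \<noteq> {}"
        using x sp by (auto simp: space_PiM PiE_eq_empty_iff dest: subprob_space.subprob_not_empty)
    qed
  qed
qed

section \<open>Greedy choice, histories and elementary inequalities\<close>

lemma greedy_props:
  assumes "K \<ge> 1"
  shows greedy_mem: "greedy K f \<in> {1..K}" and greedy_max: "c \<in> {1..K} \<Longrightarrow> f c \<le> f (greedy K f)"
proof -
  have "\<exists>a. a \<in> {1..K} \<and> (\<forall>c\<in>{1..K}. f c \<le> f a)"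
  proof -
    have *: "finite (f ` {1..K})" "f ` {1..K} \<noteq> {}" using assms by auto
    obtain a where "a \<in> {1..K}" "f a = Max (f ` {1..K})" using Max_in[OF *] by auto
    then show ?thesis using Max_ge[OF *(1)] by auto
  qed
  from LeastI_ex[OF this] show "greedy K f \<in> {1..K}" and "c \<in> {1..K} \<Longrightarrow> f c \<le> f (greedy K f)"
    by (auto simp: greedy_def)
qed

lemma Max_greedy:
  assumes "K \<ge> 1"
  shows "(MAX c\<in>{1..K}. f c) = f (greedy K f)"
  by (rule Max_eqI) (use greedy_mem[OF assms, of f] greedy_max[OF assms, of _ f] in auto)

lemma greedy_cong: "(\<And>c. c \<in> {1..K} \<Longrightarrow> f c = g c) \<Longrightarrow> greedy K f = greedy K g"
  unfolding greedy_def by (rule arg_cong[where f=Least]) (auto simp: fun_eq_iff)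

lemma space_histM [simp]: "space histM = UNIV"
  by (auto simp: histM_def obsM_def space_PiM space_pair_measure PiE_def extensional_def)

lemma space_obsM [simp]: "space obsM = UNIV"
  by (simp add: obsM_def space_pair_measure)

lemma measurable_histM_component [measurable]: "(\<lambda>h. h k) \<in> histM \<rightarrow>\<^sub>M obsM"
  unfolding histM_def by (rule measurable_component_singleton) simp

lemma measurable_obsM_proj [measurable]:
  "fst \<in> obsM \<rightarrow>\<^sub>M count_space UNIV"
  "(\<lambda>x. fst (snd x)) \<in> obsM \<rightarrow>\<^sub>M count_space UNIV"
  "(\<lambda>x. snd (snd x)) \<in> obsM \<rightarrow>\<^sub>M borel"
  unfolding obsM_def by measurable

lemma measurable_hist_obs [measurable]:
  "(\<lambda>h. fst (h k)) \<in> histM \<rightarrow>\<^sub>M count_space UNIV"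
  "(\<lambda>h. fst (snd (h k))) \<in> histM \<rightarrow>\<^sub>M count_space UNIV"
  "(\<lambda>h. snd (snd (h k))) \<in> histM \<rightarrow>\<^sub>M borel"
  by measurable

lemma measurable_obsM_reward [measurable]: "(\<lambda>r. (s, a, r)) \<in> borel \<rightarrow>\<^sub>M obsM"
  unfolding obsM_def by measurable

text \<open>Turns a product over a random index set into one over a fixed range, where measurability
  in \<open>h\<close> and exchange with other products are immediate.\<close>

lemma prod_pulls:
  "(\<Prod>k\<in>pulls m h s a. F k) = (\<Prod>k<m. if fst (h k) = s \<and> fst (snd (h k)) = a then F k else 1)"
  unfolding pulls_def by (subst prod.inter_filter[symmetric]) (auto intro!: prod.cong)

text \<open>A nonintegrable function has Bochner integral 0, so the bound holds in every case. The
  regret, defined by Bochner integrals, can therefore be bounded by nonnegative integrals.\<close>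

lemma ennreal_integral_le_nn_integral:
  assumes "AE x in M. 0 \<le> f x"
  shows "ennreal (\<integral>x. f x \<partial>M) \<le> (\<integral>\<^sup>+x. ennreal (f x) \<partial>M)"
proof (cases "integrable M f")
  case True
  then show ?thesis using assms by (simp add: nn_integral_eq_integral)
qed (simp add: not_integrable_integral_eq)

lemma clip_bounds:
  fixes c e w :: real
  assumes "\<bar>e - c\<bar> \<le> w" "0 \<le> c" "c \<le> 1"
  shows "c \<le> max 0 (min 1 (e + w)) \<and> max 0 (min 1 (e + w)) \<le> c + min 1 (2 * w)"
  using assms by linarith

text \<open>Makes sums of reciprocal square roots telescope.\<close>

lemma inverse_sqrt_le_sqrt_diff:
  assumes "x \<ge> (0::real)"
  shows "1 / sqrt (x + 1) \<le> 2 * (sqrt (x + 1) - sqrt x)"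
proof -
  have p: "sqrt (x + 1) > 0" using assms by simp
  have "(sqrt (x + 1) - sqrt x) * (sqrt (x + 1) + sqrt x) = 1"
    using assms by (simp add: algebra_simps)
  moreover have "(sqrt (x + 1) - sqrt x) * (sqrt (x + 1) + sqrt x) \<le> (sqrt (x + 1) - sqrt x) * (2 * sqrt (x + 1))"
    by (intro mult_left_mono) (use assms in auto)
  ultimately show ?thesis using p by (simp add: field_simps)
qed

text \<open>Here M stands for SK and L for ln T. The arithmetic-geometric mean inequality gives
  (sqrt (2 L) + 1)^2 \<le> 4 L + 2, and M \<le> T gives M \<le> sqrt (M T), so the summand 4 M
  merges with the leading term.\<close>

lemma regret_arithmetic:
  fixes M N T L :: real
  assumes "M \<ge> 1" "N \<ge> 1" "L \<ge> 0" and T: "M \<le> T"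
  shows "2 * M * N + 4 * sqrt 2 * sqrt L * sqrt (M * T) + 4 * M \<le>
    2 * M * N + 4 * sqrt ((2 + 6 * L) * (M * N * T))"
proof -
  have "sqrt (2 * L) \<le> (2 * L + 1) / 2"
    using arith_geo_mean_sqrt[of "2 * L" 1] assms by simp
  then have "(sqrt (2 * L) + 1)\<^sup>2 \<le> 2 + 6 * L"
    using assms by (simp add: power2_sum)
  then have 1: "sqrt (2 * L) + 1 \<le> sqrt (2 + 6 * L)" by (rule real_le_rsqrt)
  have 2: "M \<le> sqrt (M * T)" using assms by (intro real_le_rsqrt) (simp add: power2_eq_square)
  have "sqrt 2 * sqrt L * sqrt (M * T) + M \<le> (sqrt (2 * L) + 1) * sqrt (M * T)"
    using 2 by (simp add: real_sqrt_mult distrib_right)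
  also have "\<dots> \<le> sqrt (2 + 6 * L) * sqrt (M * T)"
    using 1 assms by (intro mult_right_mono) auto
  also have "\<dots> \<le> sqrt (2 + 6 * L) * sqrt (M * N * T)"
    using assms by (intro mult_left_mono real_sqrt_le_mono mult_right_mono) auto
  finally show ?thesis by (simp add: real_sqrt_mult)
qed

section \<open>Rewards, posteriors and a single agent\<close>

text \<open>The point \<open>v0\<close> of \<open>\<Theta>\<close> is the reference parameter
  against which all likelihoods are measured.\<close>

locale ts_bandit =
  fixes PS :: "'s::finite pmf" and K N :: nat and \<nu> :: "real measure"
    and b Tf \<eta> A :: "real \<Rightarrow> real" and \<Theta> :: "real set"
    and Q :: "'s \<Rightarrow> nat \<Rightarrow> real measure" and v0 :: real
  assumes K_pos: "K \<ge> 1" and N_pos: "N \<ge> 1"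
    and base_sets: "sets \<nu> = sets borel"
    and rewards_unit: "emeasure \<nu> (UNIV - {0..1}) = 0"
    and b_meas [measurable]: "b \<in> borel_measurable borel" and b_nonneg: "b r \<ge> 0"
    and T_meas [measurable]: "Tf \<in> borel_measurable borel"
    and eta_meas [measurable]: "\<eta> \<in> borel_measurable borel"
    and A_meas [measurable]: "A \<in> borel_measurable borel"
    and normalized: "v \<in> \<Theta> \<Longrightarrow> (\<integral>\<^sup>+r. ennreal (b r * exp (\<eta> v * Tf r - A v)) \<partial>\<nu>) = 1"
    and prior_prob: "prob_space (Q s a)" and prior_sets: "sets (Q s a) = sets borel"
    and prior_AE: "AE v in Q s a. v \<in> \<Theta>"
    and v0: "v0 \<in> \<Theta>"
begin

declare One_nat_def [simp del]

lemmas base_sets' [measurable_cong] = base_sets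
lemmas prior_sets' [measurable_cong, simp] = prior_sets
lemmas prior_space [simp] = sets_eq_imp_space_eq[OF prior_sets, simplified]

abbreviation rew :: "real \<Rightarrow> real measure" where "rew \<equiv> ef_dist \<nu> b Tf \<eta> A"
abbreviation mu :: "real \<Rightarrow> real" where "mu \<equiv> ef_mean \<nu> b Tf \<eta> A"
abbreviation post where "post \<equiv> posterior Q b Tf \<eta> A"
abbreviation agent where "agent \<equiv> ts_agent PS K \<nu> b Tf \<eta> A Q"
abbreviation round where "round \<equiv> ts_round PS K N \<nu> b Tf \<eta> A Q"
abbreviation run where "run \<equiv> ts_run PS K N \<nu> b Tf \<eta> A Q"
abbreviation prior where "prior \<equiv> instance_prior K Q"

definition dens :: "real \<Rightarrow> real \<Rightarrow> real" where
  "dens v r = b r * exp (\<eta> v * Tf r - A v)"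

text \<open>The density of \<open>rew v\<close> with respect to the fixed probability measure \<open>rew v0\<close>; it vanishes
  where \<open>b\<close> does because \<open>x / 0 = 0\<close>. Passing to this reference measure is what makes
  Fubini applicable, since \<open>\<nu>\<close> need not be sigma-finite.\<close>
definition rdens :: "real \<Rightarrow> real \<Rightarrow> real" where
  "rdens v r = dens v r / dens v0 r"

definition good :: "('s \<times> nat \<Rightarrow> real) \<Rightarrow> bool" where
  "good \<theta> \<longleftrightarrow> (\<forall>s. \<forall>a\<in>{1..K}. \<theta> (s, a) \<in> \<Theta>)"

lemma dens_nonneg: "dens v r \<ge> 0" by (simp add: dens_def b_nonneg)
lemma rdens_nonneg: "rdens v r \<ge> 0" by (simp add: rdens_def dens_nonneg)

text \<open>Also true where the quotient divides by 0: \<open>dens v0 r\<close> vanishes only if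
  \<open>b r\<close> does, and then so does \<open>dens v r\<close>.\<close>

lemma dens_eq: "dens v r = dens v0 r * rdens v r"
  by (auto simp: rdens_def dens_def)

text \<open>The exponential factor is positive, so all reward laws have the common support where
  \<open>b\<close> is positive. Positivity of the evidence rests on this.\<close>

lemma rdens_pos_iff: "rdens v r > 0 \<longleftrightarrow> b r > 0"
  using b_nonneg[of r] by (auto simp: rdens_def dens_def zero_less_divide_iff zero_less_mult_iff)

lemma measurable_dens [measurable (raw)]:
  assumes [measurable]: "f \<in> borel_measurable M" "g \<in> borel_measurable M"
  shows "(\<lambda>x. dens (f x) (g x)) \<in> borel_measurable M"
  unfolding dens_def by measurable

lemma measurable_rdens [measurable (raw)]:
  assumes [measurable]: "f \<in> borel_measurable M" "g \<in> borel_measurable M"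
  shows "(\<lambda>x. rdens (f x) (g x)) \<in> borel_measurable M"
  unfolding rdens_def by measurable

lemma rew_eq: "rew v = density \<nu> (\<lambda>r. ennreal (dens v r))"
  by (simp add: ef_dist_def dens_def)

lemma sets_rew [simp, measurable_cong]: "sets (rew v) = sets borel"
  by (simp add: rew_eq base_sets)

lemma space_rew [simp]: "space (rew v) = UNIV"
  using sets_eq_imp_space_eq[OF sets_rew] by simp

lemma rew_density: "rew v = density (rew v0) (\<lambda>r. ennreal (rdens v r))"
  unfolding rew_eq
  by (subst density_density_eq)
    (auto simp: ennreal_mult'[symmetric] dens_nonneg dens_eq[of v, symmetric])

lemma prob_space_rew: assumes "v \<in> \<Theta>" shows "prob_space (rew v)"
proof
  have "emeasure (rew v) (space (rew v)) = (\<integral>\<^sup>+r. ennreal (dens v r) \<partial>\<nu>)"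
    unfolding rew_eq using sets_eq_imp_space_eq[OF base_sets]
    by (subst emeasure_density) (auto simp: base_sets intro!: nn_integral_cong)
  then show "emeasure (rew v) (space (rew v)) = 1"
    using normalized[OF assms] by (simp add: dens_def)
qed

lemma AE_rew: "AE r in rew v. r \<in> {0..1}"
proof -
  have "AE r in \<nu>. r \<in> {0..1}"
    by (rule AE_I[of _ _ "UNIV - {0..1}"]) (auto simp: rewards_unit base_sets)
  then show ?thesis unfolding rew_eq by (subst AE_density) auto
qed

lemma mu_range: assumes "v \<in> \<Theta>" shows "mu v \<in> {0..1}"
proof -
  interpret prob_space "rew v" by (rule prob_space_rew[OF assms])
  have "integrable (rew v) (\<lambda>r. r)"
    by (rule integrable_const_bound[of _ 1]) (use AE_rew[of v] in auto)
  then have "(\<integral>r. r \<partial>rew v) \<le> (\<integral>r. 1 \<partial>rew v)"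
    by (intro integral_mono_AE) (use AE_rew[of v] in auto)
  moreover have "0 \<le> (\<integral>r. r \<partial>rew v)"
    by (rule integral_nonneg_AE) (use AE_rew[of v] in auto)
  ultimately show ?thesis using prob_space by (simp add: ef_mean_def)
qed

lemma measurable_mu [measurable]: "mu \<in> borel_measurable borel"
proof -
  interpret prob_space "rew v0" by (rule prob_space_rew[OF v0])
  \<comment> \<open>The parameter moves from the measure into the integrand, so that measurability
    in it follows for the fixed probability measure \<open>rew v0\<close>.\<close>
  have "mu v = (\<integral>r. rdens v r * r \<partial>rew v0)" for v
    unfolding ef_mean_def by (subst rew_density, subst integral_density) (auto simp: rdens_nonneg)
  moreover have "(\<lambda>v. \<integral>r. rdens v r * r \<partial>rew v0) \<in> borel_measurable borel"
    by measurable
  ultimately show ?thesis by (subst measurable_cong) auto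
qed

section \<open>Likelihoods relative to the reference parameter, and posteriors\<close>

definition lik :: "nat \<Rightarrow> (nat \<Rightarrow> 's obs) \<Rightarrow> 's \<Rightarrow> nat \<Rightarrow> real \<Rightarrow> real" where
  "lik m h s a v = (\<Prod>k\<in>pulls m h s a. rdens v (snd (snd (h k))))"

definition evid :: "nat \<Rightarrow> (nat \<Rightarrow> 's obs) \<Rightarrow> 's \<Rightarrow> nat \<Rightarrow> ennreal" where
  "evid m h s a = (\<integral>\<^sup>+u. ennreal (lik m h s a u) \<partial>Q s a)"

lemma lik_nonneg: "lik m h s a v \<ge> 0"
  unfolding lik_def by (intro prod_nonneg rdens_nonneg)

lemma measurable_lik [measurable (raw)]:
  assumes [measurable]: "H \<in> M \<rightarrow>\<^sub>M histM" "f \<in> borel_measurable M"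
  shows "(\<lambda>x. lik m (H x) s a (f x)) \<in> borel_measurable M"
  unfolding lik_def prod_pulls by measurable

lemma measurable_evid [measurable]: "(\<lambda>h. evid m h s a) \<in> borel_measurable histM"
proof -
  interpret prob_space "Q s a" by (rule prior_prob)
  show ?thesis unfolding evid_def by measurable
qed

text \<open>\<open>likelihood\<close> is \<open>lik\<close> times a factor \<open>c\<close> that is
  free of the parameter and cancels in the quotient. If \<open>c\<close> is 0, some factor of
  \<open>lik\<close> is a quotient by 0, so \<open>lik\<close> vanishes too and both densities are
  0.\<close>

lemma post_eq: "post m h s a = density (Q s a) (\<lambda>v. ennreal (lik m h s a v) / evid m h s a)"
proof -
  define c where "c = (\<Prod>k\<in>pulls m h s a. dens v0 (snd (snd (h k))))"
  have c: "c \<ge> 0" unfolding c_def by (intro prod_nonneg dens_nonneg)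
  have fin: "finite (pulls m h s a)" by (simp add: pulls_def)
  have L: "likelihood b Tf \<eta> A m h s a v = c * lik m h s a v" for v
    unfolding likelihood_def c_def lik_def prod.distrib[symmetric]
    by (intro prod.cong refl) (use dens_eq in \<open>simp add: dens_def\<close>)
  have Z: "(\<integral>\<^sup>+u. ennreal (c * lik m h s a u) \<partial>Q s a) = ennreal c * evid m h s a"
    unfolding evid_def by (subst nn_integral_cmult[symmetric]) (auto simp: c ennreal_mult')
  have "ennreal (c * lik m h s a v) / (ennreal c * evid m h s a) = ennreal (lik m h s a v) / evid m h s a" for v
  proof (cases "c = 0")
    case True
    then obtain k where "k \<in> pulls m h s a" "dens v0 (snd (snd (h k))) = 0"
      using fin by (auto simp: c_def)
    then have "lik m h s a v = 0"
      unfolding lik_def using fin by (auto simp: rdens_def)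
    with True show ?thesis by simp
  next
    case False
    with c have "ennreal c \<noteq> 0" "ennreal c \<noteq> \<top>" by auto
    then show ?thesis
      by (subst ennreal_mult'[OF c]) (metis divide_mult_eq infinity_ennreal_def mult.commute)
  qed
  then show ?thesis unfolding posterior_def L Z by simp
qed

lemma sets_post [simp, measurable_cong]: "sets (post m h s a) = sets borel"
  by (simp add: post_eq)

lemma emeasure_post: "emeasure (post m h s a) (space (post m h s a)) = evid m h s a / evid m h s a"
  unfolding post_eq evid_def
  by (subst emeasure_density) (auto simp: nn_integral_divide intro!: nn_integral_cong)

text \<open>The mass is x / x for the evidence x, which in \<open>ennreal\<close> is 1 for 0 < x <
  \<top> and 0 in the two extreme cases.\<close>

lemma subprob_space_post: "subprob_space (post m h s a)"
proof
  show "emeasure (post m h s a) (space (post m h s a)) \<le> 1"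
    unfolding emeasure_post
    by (cases "evid m h s a = 0 \<or> evid m h s a = \<top>") (auto simp: less_top)
  show "space (post m h s a) \<noteq> {}"
    using sets_eq_imp_space_eq[OF sets_post] by auto
qed

lemma prob_space_post: "0 < evid m h s a \<Longrightarrow> evid m h s a < \<top> \<Longrightarrow> prob_space (post m h s a)"
  by (rule prob_spaceI) (simp add: emeasure_post)

lemma measurable_post [measurable]: "(\<lambda>h. post m h s a) \<in> histM \<rightarrow>\<^sub>M subprob_algebra borel"
proof (rule measurable_subprob_algebra)
  fix X :: "real set" assume [measurable]: "X \<in> sets borel"
  interpret prob_space "Q s a" by (rule prior_prob)
  have "(\<lambda>h. \<integral>\<^sup>+v. ennreal (lik m h s a v) / evid m h s a * indicator X v \<partial>Q s a) \<in> borel_measurable histM"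
    by measurable
  then show "(\<lambda>h. emeasure (post m h s a) X) \<in> borel_measurable histM"
    unfolding post_eq by (subst measurable_cong, subst emeasure_density) auto
qed (auto simp: subprob_space_post)

definition postM :: "nat \<Rightarrow> (nat \<Rightarrow> 's obs) \<Rightarrow> 's \<Rightarrow> (nat \<Rightarrow> real) measure" where
  "postM m h s = PiM {1..K} (\<lambda>a. post m h s a)"

lemma measurable_postM [measurable]:
  "(\<lambda>h. postM m h s) \<in> histM \<rightarrow>\<^sub>M subprob_algebra (PiM {1..K} (\<lambda>_. borel))"
  unfolding postM_def by (intro measurable_PiM_kernel) auto

lemma sets_postM [simp, measurable_cong]: "sets (postM m h s) = sets (PiM {1..K} (\<lambda>_. borel))"
  unfolding postM_def by (intro sets_PiM_cong) auto

lemma subprob_space_postM: "subprob_space (postM m h s)"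
  using subprob_space_kernel[OF measurable_postM] by simp

section \<open>The arm played and the law of one observation\<close>

definition act :: "(nat \<Rightarrow> real) \<Rightarrow> nat" where
  "act w = greedy K (\<lambda>c. mu (w c))"

lemma act_mem: "act w \<in> {1..K}"
  unfolding act_def by (rule greedy_mem[OF K_pos])

text \<open>A least element over countably many candidates is measurable once the maximality of each
  candidate is a measurable event. Coordinates are measurable only for arms in range, hence the case
  distinction.\<close>

lemma measurable_act [measurable]: "act \<in> PiM {1..K} (\<lambda>_. borel) \<rightarrow>\<^sub>M count_space UNIV"
proof -
  have "Measurable.pred (PiM {1..K} (\<lambda>_. borel)) (\<lambda>w. a \<in> {1..K} \<and> (\<forall>c\<in>{1..K}. mu (w c) \<le> mu (w a)))" for a
  proof (cases "a \<in> {1..K}")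
    case True
    have m: "(\<lambda>w. mu (w c)) \<in> borel_measurable (PiM {1..K} (\<lambda>_. borel))" if "c \<in> {1..K}" for c
      by (rule measurable_compose[OF measurable_component_singleton[OF that] measurable_mu])
    have "Measurable.pred (PiM {1..K} (\<lambda>_. borel)) (\<lambda>w. mu (w c) \<le> mu (w a))" if "c \<in> {1..K}" for c
      using borel_measurable_le[OF m[OF that] m[OF True]] by (simp add: pred_def)
    then have "Measurable.pred (PiM {1..K} (\<lambda>_. borel)) (\<lambda>w. \<forall>c\<in>{1..K}. mu (w c) \<le> mu (w a))"
      by (intro pred_intros_finite) auto
    with True show ?thesis by simp
  next
    case False
    then have "(\<lambda>w. a \<in> {1..K} \<and> (\<forall>c\<in>{1..K}. mu (w c) \<le> mu (w a))) = (\<lambda>_. False)" by blast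
    then show ?thesis by simp
  qed
  then show ?thesis unfolding act_def greedy_def by measurable
qed

text \<open>A good instance constrains only the arms 1..K, so every other number gets a point mass.
  This makes \<open>armM\<close> a kernel on the whole discrete space of context-arm pairs; agents
  only play arms in range.\<close>

definition armM :: "('s \<times> nat \<Rightarrow> real) \<Rightarrow> 's \<Rightarrow> nat \<Rightarrow> 's obs measure" where
  "armM \<theta> s a = (if a \<in> {1..K} then distr (rew (\<theta> (s, a))) obsM (\<lambda>r. (s, a, r)) else return obsM (s, a, 0))"

lemma armM_kernel: assumes "good \<theta>" shows "armM \<theta> s a \<in> space (subprob_algebra obsM)"
proof (cases "a \<in> {1..K}")
  case True
  interpret prob_space "rew (\<theta> (s, a))" using assms True by (intro prob_space_rew) (auto simp: good_def)
  have "prob_space (distr (rew (\<theta> (s, a))) obsM (\<lambda>r. (s, a, r)))" by (rule prob_space_distr) measurable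
  with True show ?thesis
    by (simp add: armM_def space_subprob_algebra prob_space_imp_subprob_space)
qed (auto simp: armM_def space_subprob_algebra prob_space_imp_subprob_space prob_space_return)

lemma measurable_armM: assumes "good \<theta>"
  shows "(\<lambda>x. armM \<theta> (fst x) (act (snd x))) \<in> count_space UNIV \<Otimes>\<^sub>M PiM {1..K} (\<lambda>_. borel) \<rightarrow>\<^sub>M subprob_algebra obsM"
proof -
  have "(\<lambda>x. armM \<theta> (fst x) (snd x)) \<in> count_space UNIV \<rightarrow>\<^sub>M subprob_algebra obsM"
    using armM_kernel[OF assms] by auto
  moreover have "count_space UNIV = (count_space UNIV \<Otimes>\<^sub>M count_space UNIV :: ('s \<times> nat) measure)"
    by (subst pair_measure_countable) auto
  ultimately have arm: "(\<lambda>x. armM \<theta> (fst x) (snd x)) \<in> count_space UNIV \<Otimes>\<^sub>M count_space UNIV \<rightarrow>\<^sub>M subprob_algebra obsM"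
    by simp
  have f: "(\<lambda>x. (fst x, act (snd x))) \<in> count_space UNIV \<Otimes>\<^sub>M PiM {1..K} (\<lambda>_. borel)
      \<rightarrow>\<^sub>M (count_space UNIV \<Otimes>\<^sub>M count_space UNIV :: ('s \<times> nat) measure)"
    by measurable
  show ?thesis using measurable_compose[OF f arm] by (simp only: fst_conv snd_conv)
qed

lemma agent_eq: "agent \<theta> m h = measure_pmf PS \<bind> (\<lambda>s. postM m h s \<bind> (\<lambda>w. armM \<theta> s (act w)))"
  using act_mem unfolding ts_agent_def postM_def[symmetric] act_def[symmetric] armM_def Let_def
  by simp

lemma measurable_agent_inner: assumes "good \<theta>"
  shows "(\<lambda>x. postM m (fst x) (snd x) \<bind> (\<lambda>w. armM \<theta> (snd x) (act w))) \<in> 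
    histM \<Otimes>\<^sub>M count_space UNIV \<rightarrow>\<^sub>M subprob_algebra obsM"
proof (rule measurable_bind)
  show "(\<lambda>x. postM m (fst x) (snd x)) \<in> histM \<Otimes>\<^sub>M count_space UNIV \<rightarrow>\<^sub>M subprob_algebra (PiM {1..K} (\<lambda>_. borel))"
    by (rule measurable_compose_countable'[where f="\<lambda>s x. postM m (fst x) s" and g=snd and I=UNIV])
      (auto intro: measurable_compose[OF measurable_fst measurable_postM])
  show "(\<lambda>x. armM \<theta> (snd (fst x)) (act (snd x))) \<in>
    (histM \<Otimes>\<^sub>M count_space UNIV) \<Otimes>\<^sub>M PiM {1..K} (\<lambda>_. borel) \<rightarrow>\<^sub>M subprob_algebra obsM"
    by (rule measurable_compose[OF _ measurable_armM[OF assms], of "\<lambda>x. (snd (fst x), snd x)", simplified]) measurable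
qed

lemma measurable_agent: assumes "good \<theta>"
  shows "agent \<theta> m \<in> histM \<rightarrow>\<^sub>M subprob_algebra obsM"
proof -
  have "measure_pmf PS \<in> space (subprob_algebra (count_space UNIV))"
    by (simp add: space_subprob_algebra measure_pmf.subprob_space_axioms)
  then show ?thesis unfolding agent_eq[abs_def]
    by (rule measurable_bind[OF measurable_const measurable_agent_inner[OF assms]])
qed

lemma measurable_inner_arm: assumes "good \<theta>"
  shows "(\<lambda>w. armM \<theta> s (act w)) \<in> PiM {1..K} (\<lambda>_. borel) \<rightarrow>\<^sub>M subprob_algebra obsM"
  by (rule measurable_compose[OF _ measurable_armM[OF assms], of "\<lambda>w. (s, w)", simplified]) measurable

lemma nn_integral_agent:
  assumes "good \<theta>" and [measurable]: "F \<in> borel_measurable obsM"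
  shows "(\<integral>\<^sup>+x. F x \<partial>agent \<theta> m h) =
    (\<integral>\<^sup>+s. \<integral>\<^sup>+w. \<integral>\<^sup>+r. F (s, act w, r) \<partial>rew (\<theta> (s, act w)) \<partial>postM m h s \<partial>measure_pmf PS)"
proof -
  have 1: "(\<lambda>s. postM m h s \<bind> (\<lambda>w. armM \<theta> s (act w))) \<in> measure_pmf PS \<rightarrow>\<^sub>M subprob_algebra obsM"
    by (rule measurable_compose[OF _ measurable_agent_inner[OF assms(1)], of "\<lambda>s. (h, s)", simplified])
       (auto simp: space_pair_measure)
  have 2: "(\<lambda>w. armM \<theta> s (act w)) \<in> postM m h s \<rightarrow>\<^sub>M subprob_algebra obsM" for s
    using measurable_inner_arm[OF assms(1)] by simp
  show ?thesis unfolding agent_eq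
    by (subst nn_integral_bind[OF assms(2) 1], intro nn_integral_cong, subst nn_integral_bind[OF assms(2) 2])
       (use act_mem in \<open>auto simp: armM_def nn_integral_distr\<close>)
qed

lemma subprob_space_agent: "good \<theta> \<Longrightarrow> subprob_space (agent \<theta> m h)"
  and sets_agent: "good \<theta> \<Longrightarrow> sets (agent \<theta> m h) = sets obsM"
  by (simp_all add: subprob_space_kernel[OF measurable_agent] sets_kernel[OF measurable_agent])

section \<open>Rounds, runs and their likelihood ratios\<close>

definition upd :: "nat \<Rightarrow> (nat \<Rightarrow> 's obs) \<Rightarrow> (nat \<Rightarrow> 's obs) \<Rightarrow> nat \<Rightarrow> 's obs" where
  "upd j h ob k = (if j * N \<le> k \<and> k < Suc j * N then ob (k - j * N) else h k)"

definition agents :: "('s \<times> nat \<Rightarrow> real) \<Rightarrow> nat \<Rightarrow> (nat \<Rightarrow> 's obs) \<Rightarrow> (nat \<Rightarrow> 's obs) measure" where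
  "agents \<theta> j h = PiM {..<N} (\<lambda>_. agent \<theta> (j * N) h)"

lemma upd_old: "k < j * N \<Longrightarrow> upd j h ob k = h k"
  by (simp add: upd_def)

lemma upd_new: "n < N \<Longrightarrow> upd j h ob (j * N + n) = ob n"
  by (simp add: upd_def)

lemma round_eq: "round \<theta> j h = distr (agents \<theta> j h) histM (upd j h)"
  unfolding ts_round_def agents_def by (simp add: upd_def[abs_def])

lemma measurable_upd [measurable]:
  "(\<lambda>x. upd j (fst x) (snd x)) \<in> histM \<Otimes>\<^sub>M PiM {..<N} (\<lambda>_. obsM) \<rightarrow>\<^sub>M histM"
proof -
  let ?D = "histM \<Otimes>\<^sub>M PiM {..<N} (\<lambda>_. obsM) :: ((nat \<Rightarrow> 's obs) \<times> (nat \<Rightarrow> 's obs)) measure"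
  have "(\<lambda>x. upd j (fst x) (snd x) k) \<in> ?D \<rightarrow>\<^sub>M obsM" for k
  proof (cases "j * N \<le> k \<and> k < Suc j * N")
    case True
    then have "k - j * N \<in> {..<N}" by auto
    from measurable_compose[OF measurable_snd measurable_component_singleton[OF this]] True
    show ?thesis by (simp add: upd_def)
  next
    case False
    then have "(\<lambda>x. upd j (fst x) (snd x) k) = (\<lambda>x. fst x k)" by (auto simp: upd_def)
    then show ?thesis using measurable_compose[OF measurable_fst measurable_histM_component] by simp
  qed
  then show ?thesis
    unfolding histM_def by (intro measurable_PiM_single') auto
qed

lemma measurable_agents: "good \<theta> \<Longrightarrow> agents \<theta> j \<in> histM \<rightarrow>\<^sub>M subprob_algebra (PiM {..<N} (\<lambda>_. obsM))"
  unfolding agents_def[abs_def] by (intro measurable_PiM_kernel measurable_agent) auto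

lemma sets_agents: "good \<theta> \<Longrightarrow> sets (agents \<theta> j h) = sets (PiM {..<N} (\<lambda>_. obsM))"
  using sets_kernel[OF measurable_agents] by simp

lemma measurable_round: assumes "good \<theta>"
  shows "round \<theta> j \<in> histM \<rightarrow>\<^sub>M subprob_algebra histM"
  unfolding round_eq[abs_def]
  by (rule measurable_distr2[OF _ measurable_agents[OF assms]]) (simp add: split_beta')

lemma run_kernel: "good \<theta> \<Longrightarrow> run \<theta> j \<in> space (subprob_algebra histM)"
proof (induction j)
  case 0
  then show ?case
    by (simp add: space_subprob_algebra prob_space_imp_subprob_space prob_space_return)
next
  case (Suc j)
  from Suc(1)[OF Suc(2)] have 1: "subprob_space (run \<theta> j)" "sets (run \<theta> j) = sets histM"
    by (auto simp: space_subprob_algebra)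
  have k: "round \<theta> j \<in> run \<theta> j \<rightarrow>\<^sub>M subprob_algebra histM"
    using measurable_round[OF Suc(2)] by (simp cong: measurable_cong_sets add: 1)
  then show ?case
    using subprob_space_bind[OF 1(1) k] sets_bind[of "run \<theta> j" "round \<theta> j" histM, OF sets_kernel[OF k]]
    by (simp add: space_subprob_algebra sets_eq_imp_space_eq[OF 1(2)])
qed

lemma subprob_space_run: "good \<theta> \<Longrightarrow> subprob_space (run \<theta> j)"
  and sets_run: "good \<theta> \<Longrightarrow> sets (run \<theta> j) = sets histM"
  using run_kernel by (auto simp: space_subprob_algebra)

lemma measurable_run_cong: "good \<theta> \<Longrightarrow> borel_measurable (run \<theta> j) = borel_measurable histM"
  by (intro measurable_cong_sets sets_run refl)

lemma nn_integral_round: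
  assumes "good \<theta>" and F: "F \<in> borel_measurable histM"
  shows "(\<integral>\<^sup>+x. F x \<partial>round \<theta> j h) = (\<integral>\<^sup>+ob. F (upd j h ob) \<partial>agents \<theta> j h)"
proof -
  have "upd j h \<in> PiM {..<N} (\<lambda>_. obsM) \<rightarrow>\<^sub>M histM"
    using measurable_compose[OF measurable_Pair1' measurable_upd, of h j] by simp
  then have "upd j h \<in> agents \<theta> j h \<rightarrow>\<^sub>M histM"
    by (simp cong: measurable_cong_sets add: sets_agents assms)
  then show ?thesis unfolding round_eq by (rule nn_integral_distr) (simp add: F)
qed

lemma nn_integral_run_Suc:
  assumes "good \<theta>" and F: "F \<in> borel_measurable histM"
  shows "(\<integral>\<^sup>+x. F x \<partial>run \<theta> (Suc j)) = (\<integral>\<^sup>+h. \<integral>\<^sup>+ob. F (upd j h ob) \<partial>agents \<theta> j h \<partial>run \<theta> j)"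
proof -
  have "round \<theta> j \<in> run \<theta> j \<rightarrow>\<^sub>M subprob_algebra histM"
    using measurable_round[OF assms(1)] by (simp cong: measurable_cong_sets add: sets_run assms)
  then show ?thesis by (simp add: nn_integral_bind[OF F] nn_integral_round assms)
qed

lemma measurable_agents_integral:
  assumes "good \<theta>" and [measurable]: "F \<in> borel_measurable histM"
  shows "(\<lambda>h. \<integral>\<^sup>+ob. F (upd j h ob) \<partial>agents \<theta> j h) \<in> borel_measurable histM"
proof (rule nn_integral_measurable_subprob_algebra2[OF _ measurable_agents[OF assms(1)]])
  have "(\<lambda>x. F (upd j (fst x) (snd x))) \<in> borel_measurable (histM \<Otimes>\<^sub>M PiM {..<N} (\<lambda>_. obsM))"
    by measurable
  then show "(\<lambda>(x, y). F (upd j x y)) \<in> borel_measurable (histM \<Otimes>\<^sub>M PiM {..<N} (\<lambda>_. obsM))"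
    by (simp add: split_beta')
qed

section \<open>Likelihood ratios against the reference instance\<close>

definition arms :: "('s \<times> nat) set" where "arms = UNIV \<times> {1..K}"

lemma finite_arms [simp]: "finite arms" by (simp add: arms_def)

text \<open>At most one factor differs from 1; in this shape the product over pairs can be exchanged
  with the product over time. Observations of arms out of range have density 1.\<close>

definition obs_dens :: "('s \<times> nat \<Rightarrow> real) \<Rightarrow> 's obs \<Rightarrow> real" where
  "obs_dens \<theta> x = (\<Prod>p\<in>arms. if fst x = fst p \<and> fst (snd x) = snd p then rdens (\<theta> p) (snd (snd x)) else 1)"

definition hist_dens :: "nat \<Rightarrow> ('s \<times> nat \<Rightarrow> real) \<Rightarrow> (nat \<Rightarrow> 's obs) \<Rightarrow> real" where
  "hist_dens m \<theta> h = (\<Prod>p\<in>arms. lik m h (fst p) (snd p) (\<theta> p))"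

lemma obs_dens_nonneg: "obs_dens \<theta> x \<ge> 0"
  unfolding obs_dens_def by (intro prod_nonneg) (auto simp: rdens_nonneg)

lemma obs_dens_arm: assumes "a \<in> {1..K}" shows "obs_dens \<theta> (s, a, r) = rdens (\<theta> (s, a)) r"
proof -
  have "obs_dens \<theta> (s, a, r) = (\<Prod>p\<in>arms. if p = (s, a) then rdens (\<theta> p) r else 1)"
    unfolding obs_dens_def by (intro prod.cong) auto
  then show ?thesis using assms by (simp add: arms_def prod.delta)
qed

text \<open>Read per pair, the density separates over the independent priors and yields the
  posteriors; read per time step, it follows the rounds of a run. Exchanging two finite products
  links the readings.\<close>

lemma hist_dens_eq: "hist_dens m \<theta> h = (\<Prod>k<m. obs_dens \<theta> (h k))"
  unfolding hist_dens_def lik_def prod_pulls obs_dens_def by (rule prod.swap)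

lemma measurable_obs_dens [measurable]: "obs_dens \<theta> \<in> borel_measurable obsM"
  unfolding obs_dens_def[abs_def] by measurable

lemma sets_prior: "sets prior = sets (PiM arms (\<lambda>_. borel))"
  unfolding instance_prior_def arms_def by (intro sets_PiM_cong) auto

lemma prob_space_prior: "prob_space prior"
  unfolding instance_prior_def by (intro prob_space_PiM) (auto simp: prior_prob)

lemma measurable_prior_component: "p \<in> arms \<Longrightarrow> (\<lambda>\<theta>. \<theta> p) \<in> borel_measurable prior"
  using measurable_component_singleton[of p arms "\<lambda>_. borel::real measure"]
  by (simp cong: measurable_cong_sets add: sets_prior)

lemma measurable_hist_dens [measurable]: "(\<lambda>x. hist_dens m (fst x) (snd x)) \<in> borel_measurable (prior \<Otimes>\<^sub>M histM)"
  unfolding hist_dens_def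
  by (intro borel_measurable_prod measurable_lik measurable_snd
     measurable_compose[OF measurable_fst measurable_prior_component])

lemma measurable_hist_dens2 [measurable]: "hist_dens m \<theta> \<in> borel_measurable histM"
  unfolding hist_dens_eq[abs_def] by measurable

abbreviation (input) ref :: "'s \<times> nat \<Rightarrow> real" where "ref \<equiv> \<lambda>_. v0"

lemma good_ref: "good ref" by (simp add: good_def v0)

text \<open>Context and sampled arm have the same law for every instance, since the posterior
  depends on the history only. Just the reward law changes, by the factor
  \<open>rdens\<close>.\<close>

lemma agent_density:
  assumes "good \<theta>"
  shows "agent \<theta> m h = density (agent ref m h) (\<lambda>x. ennreal (obs_dens \<theta> x))"
proof (rule measure_eqI)
  note s = sets_agent[OF assms] sets_agent[OF good_ref]
  show "sets (agent \<theta> m h) = sets (density (agent ref m h) (\<lambda>x. ennreal (obs_dens \<theta> x)))"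
    by (simp add: s)
  fix X assume "X \<in> sets (agent \<theta> m h)"
  then have X[measurable]: "X \<in> sets obsM" by (simp add: s)
  have in_arm: "(\<integral>\<^sup>+r. indicator X (s, a, r) \<partial>rew (\<theta> (s, a))) =
    (\<integral>\<^sup>+r. ennreal (obs_dens \<theta> (s, a, r)) * indicator X (s, a, r) \<partial>rew v0)" if "a \<in> {1..K}" for s a
    by (subst rew_density, subst nn_integral_density) (auto simp: obs_dens_arm[OF that])
  have "emeasure (agent \<theta> m h) X = (\<integral>\<^sup>+x. indicator X x \<partial>agent \<theta> m h)"
    by (simp add: s X)
  also have "\<dots> = (\<integral>\<^sup>+s. \<integral>\<^sup>+w. \<integral>\<^sup>+r. indicator X (s, act w, r) \<partial>rew (\<theta> (s, act w)) \<partial>postM m h s \<partial>measure_pmf PS)"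
    by (rule nn_integral_agent[OF assms]) measurable
  also have "\<dots> = (\<integral>\<^sup>+s. \<integral>\<^sup>+w. \<integral>\<^sup>+r. ennreal (obs_dens \<theta> (s, act w, r)) * indicator X (s, act w, r)
      \<partial>rew v0 \<partial>postM m h s \<partial>measure_pmf PS)"
    by (intro nn_integral_cong in_arm act_mem)
  also have "\<dots> = (\<integral>\<^sup>+x. ennreal (obs_dens \<theta> x) * indicator X x \<partial>agent ref m h)"
    by (rule nn_integral_agent[OF good_ref, symmetric]) measurable
  also have "\<dots> = emeasure (density (agent ref m h) (\<lambda>x. ennreal (obs_dens \<theta> x))) X"
    using measurable_obs_dens[of \<theta>]
    by (subst emeasure_density) (auto simp: s X cong: measurable_cong_sets)
  finally show "emeasure (agent \<theta> m h) X = emeasure (density (agent ref m h) (\<lambda>x. ennreal (obs_dens \<theta> x))) X" .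
qed

lemma sigma_finite_agent: "good \<theta> \<Longrightarrow> sigma_finite_measure (agent \<theta> m h)"
  by (meson finite_measure.axioms(1) subprob_space.axioms(1) subprob_space_agent)

lemma agents_density:
  assumes "good \<theta>"
  shows "agents \<theta> j h = density (agents ref j h) (\<lambda>ob. \<Prod>n<N. ennreal (obs_dens \<theta> (ob n)))"
proof -
  have "agents \<theta> j h = PiM {..<N} (\<lambda>_. density (agent ref (j * N) h) (\<lambda>x. ennreal (obs_dens \<theta> x)))"
    unfolding agents_def by (simp add: agent_density[OF assms])
  also have "\<dots> = density (PiM {..<N} (\<lambda>_. agent ref (j * N) h)) (\<lambda>ob. \<Prod>n<N. ennreal (obs_dens \<theta> (ob n)))"
    by (rule PiM_density)
      (auto simp: agent_density[OF assms, symmetric] sigma_finite_agent assms good_ref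
         sets_agent[OF good_ref] cong: measurable_cong_sets)
  finally show ?thesis by (simp add: agents_def)
qed

lemma prod_upd:
  "(\<Prod>k<Suc j * N. X (upd j h ob k)) = (\<Prod>k<j * N. X (h k)) * (\<Prod>n<N. X (ob n) :: 'c::comm_monoid_mult)"
proof -
  have "{..<Suc j * N} = {..<j * N} \<union> (\<lambda>n. j * N + n) ` {..<N}"
  proof (intro equalityI subsetI)
    fix x assume "x \<in> {..<Suc j * N}"
    then show "x \<in> {..<j * N} \<union> (\<lambda>n. j * N + n) ` {..<N}"
      by (cases "x < j * N") (auto intro!: image_eqI[of _ _ "x - j * N"])
  qed auto
  then have "(\<Prod>k<Suc j * N. X (upd j h ob k)) =
     (\<Prod>k<j * N. X (upd j h ob k)) * (\<Prod>k\<in>(\<lambda>n. j * N + n) ` {..<N}. X (upd j h ob k))"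
    by (simp, subst prod.union_disjoint) auto
  also have "(\<Prod>k\<in>(\<lambda>n. j * N + n) ` {..<N}. X (upd j h ob k)) = (\<Prod>n<N. X (ob n))"
    by (subst prod.reindex) (auto simp: upd_new inj_on_def)
  finally show ?thesis by (simp add: upd_old)
qed

text \<open>Induction over the rounds: given the past, the N observations of a round are
  independent, so their density ratios multiply with that of the past.\<close>

lemma nn_integral_run_ref:
  assumes "good \<theta>" and "F \<in> borel_measurable histM"
  shows "(\<integral>\<^sup>+h. F h \<partial>run \<theta> j) = (\<integral>\<^sup>+h. ennreal (hist_dens (j * N) \<theta> h) * F h \<partial>run ref j)"
  using assms(2)
proof (induction j arbitrary: F)
  case 0
  then show ?case by (simp add: hist_dens_eq)
next
  case (Suc j)
  note F[measurable] = Suc.prems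
  have upd_meas: "upd j h \<in> agents ref j h \<rightarrow>\<^sub>M histM" for h
    using measurable_compose[OF measurable_Pair1' measurable_upd, of h j]
    by (simp cong: measurable_cong_sets add: sets_agents good_ref)
  have obs_meas: "(\<lambda>ob. ob n) \<in> agents ref j h \<rightarrow>\<^sub>M obsM" if "n < N" for h n
    using measurable_component_singleton[of n "{..<N}" "\<lambda>_. obsM"] that
    by (simp cong: measurable_cong_sets add: sets_agents good_ref)
  have "(\<integral>\<^sup>+h. F h \<partial>run \<theta> (Suc j)) = (\<integral>\<^sup>+h. \<integral>\<^sup>+ob. F (upd j h ob) \<partial>agents \<theta> j h \<partial>run \<theta> j)"
    by (rule nn_integral_run_Suc[OF assms(1)]) measurable
  also have "\<dots> = (\<integral>\<^sup>+h. ennreal (hist_dens (j * N) \<theta> h) * (\<integral>\<^sup>+ob. F (upd j h ob) \<partial>agents \<theta> j h) \<partial>run ref j)"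
    by (intro Suc.IH measurable_agents_integral assms F)
  also have "\<dots> = (\<integral>\<^sup>+h. \<integral>\<^sup>+ob. ennreal (hist_dens (Suc j * N) \<theta> (upd j h ob)) * F (upd j h ob) \<partial>agents ref j h \<partial>run ref j)"
  proof (intro nn_integral_cong)
    fix h
    note [measurable] = upd_meas[of h]
    have m: "(\<lambda>ob. \<Prod>n<N. ennreal (obs_dens \<theta> (ob n))) \<in> borel_measurable (agents ref j h)"
      by (intro borel_measurable_prod_ennreal measurable_compose[OF obs_meas]) auto
    have "ennreal (hist_dens (j * N) \<theta> h) * (\<integral>\<^sup>+ob. F (upd j h ob) \<partial>agents \<theta> j h) =
      ennreal (hist_dens (j * N) \<theta> h) * (\<integral>\<^sup>+ob. (\<Prod>n<N. ennreal (obs_dens \<theta> (ob n))) * F (upd j h ob) \<partial>agents ref j h)"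
      by (subst agents_density[OF assms(1)], subst nn_integral_density[OF m]) auto
    also have "\<dots> = (\<integral>\<^sup>+ob. ennreal (hist_dens (j * N) \<theta> h) * ((\<Prod>n<N. ennreal (obs_dens \<theta> (ob n))) * F (upd j h ob)) \<partial>agents ref j h)"
      using m by (subst nn_integral_cmult) auto
    also have "\<dots> = (\<integral>\<^sup>+ob. ennreal (hist_dens (Suc j * N) \<theta> (upd j h ob)) * F (upd j h ob) \<partial>agents ref j h)"
      by (intro nn_integral_cong)
        (simp only: hist_dens_eq prod_upd prod_ennreal obs_dens_nonneg prod_nonneg ennreal_mult mult.assoc)
    finally show "ennreal (hist_dens (j * N) \<theta> h) * (\<integral>\<^sup>+ob. F (upd j h ob) \<partial>agents \<theta> j h) =
       (\<integral>\<^sup>+ob. ennreal (hist_dens (Suc j * N) \<theta> (upd j h ob)) * F (upd j h ob) \<partial>agents ref j h)" .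
  qed
  also have "\<dots> = (\<integral>\<^sup>+h. ennreal (hist_dens (Suc j * N) \<theta> h) * F h \<partial>run ref (Suc j))"
    by (rule nn_integral_run_Suc[OF good_ref, symmetric]) measurable
  finally show ?case .
qed

lemma run_density:
  assumes "good \<theta>"
  shows "run \<theta> j = density (run ref j) (\<lambda>h. ennreal (hist_dens (j * N) \<theta> h))"
proof (rule measure_eqI)
  note s = sets_run[OF assms] sets_run[OF good_ref] 
  show "sets (run \<theta> j) = sets (density (run ref j) (\<lambda>h. ennreal (hist_dens (j * N) \<theta> h)))"
    by (simp add: s)
  fix X assume "X \<in> sets (run \<theta> j)"
  then have [measurable]: "X \<in> sets histM" and X: "X \<in> sets (run ref j)" by (simp_all add: s)
  have m: "(\<lambda>h. ennreal (hist_dens (j * N) \<theta> h)) \<in> borel_measurable (run ref j)"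
    unfolding measurable_run_cong[OF good_ref] by measurable
  have "emeasure (run \<theta> j) X = (\<integral>\<^sup>+h. indicator X h \<partial>run \<theta> j)" by (simp add: s)
  also have "\<dots> = emeasure (density (run ref j) (\<lambda>h. ennreal (hist_dens (j * N) \<theta> h))) X"
    by (subst nn_integral_run_ref[OF assms], measurable) (simp add: emeasure_density m X)
  finally show "emeasure (run \<theta> j) X = emeasure (density (run ref j) (\<lambda>h. ennreal (hist_dens (j * N) \<theta> h))) X" .
qed

section \<open>The joint law of instance and history\<close>

lemma prior_eq: "prior = PiM arms (\<lambda>p. Q (fst p) (snd p))"
  by (simp add: instance_prior_def arms_def split_beta')

lemma AE_prior_good: "AE \<theta> in prior. good \<theta>"
proof -
  have "AE \<theta> in prior. \<forall>p\<in>arms. \<theta> p \<in> \<Theta>"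
    unfolding prior_eq
    by (intro AE_finite_allI AE_PiM_component[where P="\<lambda>v. v \<in> \<Theta>"] prior_prob prior_AE finite_arms)
  then show ?thesis by (rule eventually_mono) (auto simp: good_def arms_def)
qed

lemma emeasure_return_histM [simp]: "emeasure (return histM x) UNIV = 1"
  using prob_space.emeasure_space_1[OF prob_space_return, of x histM] by simp

text \<open>The density of the marginal law of the history against the reference run: the likelihood
  integrated over the prior, which factorises because the prior is a product.\<close>

definition marg :: "nat \<Rightarrow> (nat \<Rightarrow> 's obs) \<Rightarrow> ennreal" where
  "marg m h = (\<Prod>p\<in>arms. evid m h (fst p) (snd p))"

lemma marg_eq: "marg m h = (\<integral>\<^sup>+\<theta>. ennreal (hist_dens m \<theta> h) \<partial>prior)"
proof -
  have "(\<integral>\<^sup>+\<theta>. (\<Prod>p\<in>arms. ennreal (lik m h (fst p) (snd p) (\<theta> p))) \<partial>prior) = marg m h"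
    unfolding prior_eq marg_def evid_def
    by (subst nn_integral_PiM_prod) (auto simp: prior_prob prob_space_imp_sigma_finite split_beta' cong: measurable_cong_sets)
  then show ?thesis by (simp add: prod_ennreal lik_nonneg hist_dens_def)
qed

lemma measurable_marg [measurable]: "marg m \<in> borel_measurable histM"
  unfolding marg_def[abs_def] by measurable

lemma pair_sigma_finite_ref: "pair_sigma_finite prior (run ref j)"
proof -
  interpret P: prob_space prior by (rule prob_space_prior)
  interpret R: subprob_space "run ref j" by (rule subprob_space_run[OF good_ref])
  show ?thesis ..
qed

text \<open>A density on a product measure instead of a mixture of runs, which gives both orders of
  integration: history outermost for Bayes' rule, instance outermost for expectations under a fixed
  instance.\<close>

definition joint :: "nat \<Rightarrow> (('s \<times> nat \<Rightarrow> real) \<times> (nat \<Rightarrow> 's obs)) measure" where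
  "joint j = density (prior \<Otimes>\<^sub>M run ref j) (\<lambda>x. ennreal (hist_dens (j * N) (fst x) (snd x)))"

lemma sets_pair_run: "sets (prior \<Otimes>\<^sub>M run ref j) = sets (prior \<Otimes>\<^sub>M histM)"
  by (intro sets_pair_measure_cong refl sets_run good_ref)

lemma sets_joint [simp, measurable_cong]: "sets (joint j) = sets (prior \<Otimes>\<^sub>M histM)"
  by (simp add: joint_def sets_pair_run)

lemma measurable_hist_dens_pair: 
  "(\<lambda>x. ennreal (hist_dens m (fst x) (snd x))) \<in> borel_measurable (prior \<Otimes>\<^sub>M run ref j)"
  unfolding measurable_cong_sets[OF sets_pair_run refl] by measurable

lemma nn_integral_joint_ref:
  assumes F: "F \<in> borel_measurable (prior \<Otimes>\<^sub>M histM)"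
  shows "(\<integral>\<^sup>+x. F x \<partial>joint j) =
    (\<integral>\<^sup>+h. \<integral>\<^sup>+\<theta>. ennreal (hist_dens (j * N) \<theta> h) * F (\<theta>, h) \<partial>prior \<partial>run ref j)"
proof -
  interpret pair_sigma_finite prior "run ref j" by (rule pair_sigma_finite_ref)
  have F': "F \<in> borel_measurable (prior \<Otimes>\<^sub>M run ref j)"
    using F by (simp add: measurable_cong_sets[OF sets_pair_run refl])
  have "(\<integral>\<^sup>+x. F x \<partial>joint j) =
    (\<integral>\<^sup>+x. ennreal (hist_dens (j * N) (fst x) (snd x)) * F x \<partial>(prior \<Otimes>\<^sub>M run ref j))"
    unfolding joint_def by (rule nn_integral_density[OF measurable_hist_dens_pair F'])
  moreover have "(\<lambda>x. ennreal (hist_dens (j * N) (fst x) (snd x)) * F x) \<in> borel_measurable (prior \<Otimes>\<^sub>M run ref j)"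
    using measurable_hist_dens_pair F' by (rule borel_measurable_times_ennreal)
  ultimately show ?thesis by (simp add: nn_integral_snd[symmetric])
qed

lemma nn_integral_joint:
  assumes F: "F \<in> borel_measurable (prior \<Otimes>\<^sub>M histM)"
  shows "(\<integral>\<^sup>+x. F x \<partial>joint j) = (\<integral>\<^sup>+\<theta>. \<integral>\<^sup>+h. F (\<theta>, h) \<partial>run \<theta> j \<partial>prior)"
proof -
  interpret pair_sigma_finite prior "run ref j" by (rule pair_sigma_finite_ref)
  have F': "F \<in> borel_measurable (prior \<Otimes>\<^sub>M run ref j)"
    using F by (simp add: measurable_cong_sets[OF sets_pair_run refl])
  have "(\<integral>\<^sup>+x. F x \<partial>joint j) =
    (\<integral>\<^sup>+x. ennreal (hist_dens (j * N) (fst x) (snd x)) * F x \<partial>(prior \<Otimes>\<^sub>M run ref j))"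
    unfolding joint_def by (rule nn_integral_density[OF measurable_hist_dens_pair F'])
  also have "\<dots> = (\<integral>\<^sup>+\<theta>. \<integral>\<^sup>+h. ennreal (hist_dens (j * N) \<theta> h) * F (\<theta>, h) \<partial>run ref j \<partial>prior)"
    by (subst M2.nn_integral_fst[OF borel_measurable_times_ennreal[OF measurable_hist_dens_pair F'], symmetric]) simp
  also have "\<dots> = (\<integral>\<^sup>+\<theta>. \<integral>\<^sup>+h. F (\<theta>, h) \<partial>run \<theta> j \<partial>prior)"
  proof (rule nn_integral_cong_AE, use AE_prior_good AE_space in eventually_elim)
    fix \<theta> assume "good \<theta>" "\<theta> \<in> space prior"
    then show "(\<integral>\<^sup>+h. ennreal (hist_dens (j * N) \<theta> h) * F (\<theta>, h) \<partial>run ref j) = (\<integral>\<^sup>+h. F (\<theta>, h) \<partial>run \<theta> j)"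
      using F by (subst nn_integral_run_ref) auto
  qed
  finally show ?thesis .
qed

lemma joint_le_1: "(\<integral>\<^sup>+x. 1 \<partial>joint j) \<le> 1"
proof -
  have "(\<integral>\<^sup>+x. 1 \<partial>joint j) = (\<integral>\<^sup>+\<theta>. \<integral>\<^sup>+h. 1 \<partial>run \<theta> j \<partial>prior)" by (rule nn_integral_joint) simp
  also have "\<dots> \<le> (\<integral>\<^sup>+\<theta>. 1 \<partial>prior)"
    using AE_prior_good
    by (intro nn_integral_mono_AE) (auto elim!: eventually_mono
       intro!: subprob_space.emeasure_space_le_1 subprob_space_run)
  also have "\<dots> = 1" using prob_space.emeasure_space_1[OF prob_space_prior] by simp
  finally show ?thesis .
qed

text \<open>The integral of the marginal density is the total mass of \<open>joint\<close>, hence at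
  most 1.\<close>

lemma AE_marg_finite: "AE h in run ref j. marg (j * N) h < \<top>"
proof -
  have "(\<integral>\<^sup>+h. marg (j * N) h \<partial>run ref j) = (\<integral>\<^sup>+x. 1 \<partial>joint j)"
    by (subst nn_integral_joint_ref) (auto simp: marg_eq[abs_def])
  also have "\<dots> \<le> 1" by (rule joint_le_1)
  finally have "(\<integral>\<^sup>+h. marg (j * N) h \<partial>run ref j) \<noteq> \<infinity>" by (auto simp: top_unique)
  then have "AE h in run ref j. marg (j * N) h \<noteq> \<infinity>"
    by (intro nn_integral_PInf_AE) (simp_all add: measurable_run_cong good_ref)
  then show ?thesis by (simp add: less_top)
qed

text \<open>The histories after which all posteriors normalise; elsewhere at least one of them is
  the zero measure.\<close>

definition regular :: "nat \<Rightarrow> (nat \<Rightarrow> 's obs) \<Rightarrow> bool" where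
  "regular m h \<longleftrightarrow> (\<forall>s. \<forall>a\<in>{1..K}. 0 < evid m h s a \<and> evid m h s a < \<top>)"

text \<open>A finite product in \<open>ennreal\<close> is infinite iff some factor is infinite and
  none is 0, so finiteness of the factors can be read off only together with positivity.\<close>

lemma regular_iff: "regular m h \<longleftrightarrow> 0 < marg m h \<and> marg m h < \<top>"
proof
  assume "regular m h"
  then show "0 < marg m h \<and> marg m h < \<top>"
    unfolding marg_def regular_def arms_def
    by (auto simp: less_top[symmetric] zero_less_iff_neq_zero ennreal_prod_eq_top)
next
  assume *: "0 < marg m h \<and> marg m h < \<top>"
  then have nz: "evid m h (fst p) (snd p) \<noteq> 0" if "p \<in> arms" for p
    using that unfolding marg_def by (auto simp: zero_less_iff_neq_zero)
  moreover have "evid m h (fst p) (snd p) \<noteq> \<top>" if "p \<in> arms" for p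
    using * nz that unfolding marg_def less_top[symmetric] by (auto simp: ennreal_prod_eq_top)
  ultimately show "regular m h"
    by (force simp: regular_def arms_def zero_less_iff_neq_zero less_top[symmetric])
qed

text \<open>One parameter of positive likelihood forces \<open>b\<close> to be positive at all
  observed rewards of the pair. By the common support every parameter then has positive likelihood,
  and so has its integral.\<close>

lemma evid_pos: assumes "lik m h s a v > 0" shows "evid m h s a > 0"
proof -
  interpret prob_space "Q s a" by (rule prior_prob)
  have fin: "finite (pulls m h s a)" by (simp add: pulls_def)
  have "lik m h s a u > 0" for u
  proof -
    have "rdens v (snd (snd (h k))) \<noteq> 0" if "k \<in> pulls m h s a" for k
    proof -
      have "lik m h s a v \<noteq> 0" using assms by simp
      with fin that show ?thesis unfolding lik_def by auto
    qed
    then have "b (snd (snd (h k))) > 0" if "k \<in> pulls m h s a" for k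
      using that rdens_nonneg[of v "snd (snd (h k))"] rdens_pos_iff by (metis less_le)
    then show ?thesis unfolding lik_def by (intro prod_pos) (auto simp: rdens_pos_iff)
  qed
  then have "(ennreal (lik m h s a u) = 0) = False" for u
    by (metis ennreal_eq_0_iff not_le)
  then have "\<not> (AE u in Q s a. ennreal (lik m h s a u) = 0)" by (simp only: AE_const) simp
  then have "evid m h s a \<noteq> 0" unfolding evid_def by (subst nn_integral_0_iff_AE) auto
  then show ?thesis by (simp add: zero_less_iff_neq_zero)
qed

text \<open>Under \<open>run \<theta>\<close> the density \<open>hist_dens\<close> is almost surely
  positive, which makes each evidence positive; finiteness comes from the marginal density. This
  works for each good instance, not only for almost all.\<close>

lemma AE_regular:
  assumes "good \<theta>"
  shows "AE h in run \<theta> j. regular (j * N) h"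
proof -
  have "AE h in run ref j. 0 < ennreal (hist_dens (j * N) \<theta> h) \<longrightarrow> regular (j * N) h"
    using AE_marg_finite[of j]
  proof eventually_elim
    case (elim h)
    show ?case
    proof
      assume "0 < ennreal (hist_dens (j * N) \<theta> h)"
      then have "lik (j * N) h (fst p) (snd p) (\<theta> p) \<noteq> 0" if "p \<in> arms" for p
      proof -
        have "hist_dens (j * N) \<theta> h \<noteq> 0" using \<open>0 < ennreal (hist_dens (j * N) \<theta> h)\<close> by auto
        with that show ?thesis by (auto simp: hist_dens_def)
      qed
      then have "lik (j * N) h (fst p) (snd p) (\<theta> p) > 0" if "p \<in> arms" for p
        using that lik_nonneg[of "j * N" h "fst p" "snd p" "\<theta> p"] by (simp add: less_le)
      from evid_pos[OF this] have "evid (j * N) h (fst p) (snd p) \<noteq> 0" if "p \<in> arms" for p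
        using that by (simp add: zero_less_iff_neq_zero)
      then have "marg (j * N) h > 0"
        unfolding marg_def zero_less_iff_neq_zero by auto
      with elim show "regular (j * N) h" by (simp add: regular_iff)
    qed
  qed
  then show ?thesis
    by (subst run_density[OF assms], subst AE_density)
       (simp_all add: measurable_run_cong[OF good_ref])
qed

lemma prob_space_postM: "regular m h \<Longrightarrow> prob_space (postM m h s)"
  unfolding postM_def by (intro prob_space_PiM prob_space_post) (auto simp: regular_def)

text \<open>The expectation of \<open>f\<close> over context and arm of one agent acting after the
  history \<open>h\<close>. No instance enters, since the arm is drawn from the posterior.\<close>

definition avg :: "nat \<Rightarrow> (nat \<Rightarrow> 's obs) \<Rightarrow> ('s \<Rightarrow> nat \<Rightarrow> ennreal) \<Rightarrow> ennreal" where
  "avg m h f = (\<Sum>s\<in>UNIV. ennreal (pmf PS s) * (\<integral>\<^sup>+w. f s (act w) \<partial>postM m h s))"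

lemma sum_pmf_PS: "(\<Sum>s\<in>UNIV. ennreal (pmf PS s)) = 1"
  by (simp add: sum_ennreal sum_pmf_eq_1)

lemma measurable_act_postM: "act \<in> postM m h s \<rightarrow>\<^sub>M count_space UNIV"
  by (simp cong: measurable_cong_sets)

lemma measurable_fun_act: "(\<lambda>w. f (act w) :: ennreal) \<in> borel_measurable (postM m h s)"
  by (rule measurable_compose[OF measurable_act_postM]) simp

lemma avg_add: "avg m h (\<lambda>s a. f s a + g s a) = avg m h f + avg m h g"
  unfolding avg_def
  by (simp add: nn_integral_add measurable_fun_act distrib_left sum.distrib)

lemma avg_mono: "(\<And>s a. a \<in> {1..K} \<Longrightarrow> f s a \<le> g s a) \<Longrightarrow> avg m h f \<le> avg m h g"
  unfolding avg_def by (intro sum_mono mult_left_mono nn_integral_mono) (auto simp: act_mem simp del: atLeastAtMost_iff)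

lemma avg_const: "regular m h \<Longrightarrow> avg m h (\<lambda>s a. f s) = (\<Sum>s\<in>UNIV. ennreal (pmf PS s) * f s)"
  unfolding avg_def by (simp add: prob_space.emeasure_space_1[OF prob_space_postM])

lemma nn_integral_agent_avg:
  assumes "good \<theta>"
  shows "(\<integral>\<^sup>+x. f (fst x) (fst (snd x)) \<partial>agent \<theta> m h) = avg m h f"
proof -
  have [measurable]: "(\<lambda>x. f (fst x) (fst (snd x))) \<in> borel_measurable obsM"
    unfolding obsM_def by measurable
  have "(\<integral>\<^sup>+r. c \<partial>rew (\<theta> (s, act w))) = c" for c :: ennreal and s w
  proof -
    interpret prob_space "rew (\<theta> (s, act w))"
      using assms act_mem by (intro prob_space_rew) (auto simp: good_def)
    show ?thesis using emeasure_space_1 by simp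
  qed
  then have "(\<integral>\<^sup>+x. f (fst x) (fst (snd x)) \<partial>agent \<theta> m h) =
      (\<integral>\<^sup>+s. \<integral>\<^sup>+w. f s (act w) \<partial>postM m h s \<partial>measure_pmf PS)"
    by (subst nn_integral_agent[OF assms]) simp_all
  also have "\<dots> = (\<Sum>s\<in>UNIV. (\<integral>\<^sup>+w. f s (act w) \<partial>postM m h s) * ennreal (pmf PS s))"
    by (rule nn_integral_measure_pmf_support) auto
  finally show ?thesis by (simp add: avg_def mult.commute)
qed

lemma prob_space_agent: assumes "good \<theta>" "regular m h" shows "prob_space (agent \<theta> m h)"
proof (rule prob_spaceI)
  show "emeasure (agent \<theta> m h) (space (agent \<theta> m h)) = 1"
    using nn_integral_agent_avg[OF assms(1), where f="\<lambda>_ _. 1", of m h] avg_const[OF assms(2), of "\<lambda>_. 1"]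
    by (simp add: sum_pmf_PS)
qed

lemma prob_space_agents: "good \<theta> \<Longrightarrow> regular (j * N) h \<Longrightarrow> prob_space (agents \<theta> j h)"
  unfolding agents_def by (intro prob_space_PiM prob_space_agent)

section \<open>Expectations of single entries along a run\<close>

definition prefix_fun :: "nat \<Rightarrow> ((nat \<Rightarrow> 's obs) \<Rightarrow> 'c) \<Rightarrow> bool" where
  "prefix_fun m F \<longleftrightarrow> (\<forall>h h'. (\<forall>k<m. h k = h' k) \<longrightarrow> F h = F h')"

lemma prefix_fun_upd: "prefix_fun (i * N) F \<Longrightarrow> i \<le> j \<Longrightarrow> F (upd j h ob) = F h"
  unfolding prefix_fun_def
  by (metis upd_old less_le_trans mult_le_mono1)

text \<open>Later rounds leave the first i * N entries alone and integrate to 1, since the agents'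
  kernels are probability measures after almost every history.\<close>

lemma nn_integral_run_prefix:
  assumes "good \<theta>" and F: "F \<in> borel_measurable histM" "prefix_fun (i * N) F" and "i \<le> j"
  shows "(\<integral>\<^sup>+h. F h \<partial>run \<theta> j) = (\<integral>\<^sup>+h. F h \<partial>run \<theta> i)"
  using \<open>i \<le> j\<close>
proof (induction j rule: dec_induct)
  case (step n)
  have "(\<integral>\<^sup>+h. F h \<partial>run \<theta> (Suc n)) = (\<integral>\<^sup>+h. \<integral>\<^sup>+ob. F h \<partial>agents \<theta> n h \<partial>run \<theta> n)"
    by (simp add: nn_integral_run_Suc assms prefix_fun_upd[OF F(2) step(1)] del: nn_integral_const ts_run.simps)
  also have "\<dots> = (\<integral>\<^sup>+h. F h \<partial>run \<theta> n)"
    using AE_regular[OF assms(1), of n]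
    by (intro nn_integral_cong_AE) (auto elim!: eventually_mono
      simp: prob_space.emeasure_space_1[OF prob_space_agents] assms(1))
  finally show ?case using step by simp
qed simp

lemma prob_space_run: assumes "good \<theta>" shows "prob_space (run \<theta> j)"
proof (rule prob_spaceI)
  have "(\<integral>\<^sup>+h. 1 \<partial>run \<theta> j) = (\<integral>\<^sup>+h. 1 \<partial>run \<theta> 0)"
    by (rule nn_integral_run_prefix[where i=0]) (auto simp: assms prefix_fun_def)
  then show "emeasure (run \<theta> j) (space (run \<theta> j)) = 1" by simp
qed

text \<open>The tower property for one pull: \<open>F\<close> is frozen at the start of round j, the
  entry is drawn from the agent's kernel, and the other agents and the later rounds integrate
  out.\<close>

lemma nn_integral_run_entry:
  assumes "good \<theta>" and F: "\<And>s a. (\<lambda>h. F h s a) \<in> borel_measurable histM" "prefix_fun (j * N) F"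
    and "j < J" "n < N"
  shows "(\<integral>\<^sup>+h. F h (fst (h (j * N + n))) (fst (snd (h (j * N + n)))) \<partial>run \<theta> J) =
     (\<integral>\<^sup>+h. avg (j * N) h (F h) \<partial>run \<theta> j)"
proof -
  let ?k = "j * N + n"
  have "(\<lambda>h. F h (fst (h ?k)) a) \<in> borel_measurable histM" for a
    by (rule measurable_compose_countable'[where f="\<lambda>s h. F h s a" and I=UNIV]) (auto simp: F)
  then have m: "(\<lambda>h. F h (fst (h ?k)) (fst (snd (h ?k)))) \<in> borel_measurable histM"
    by (rule measurable_compose_countable'[where f="\<lambda>a h. F h (fst (h ?k)) a" and I=UNIV]) auto
  have pre: "prefix_fun (Suc j * N) (\<lambda>h. F h (fst (h ?k)) (fst (snd (h ?k))))"
    unfolding prefix_fun_def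
  proof (intro allI impI)
    fix h h' :: "nat \<Rightarrow> 's obs" assume *: "\<forall>k<Suc j * N. h k = h' k"
    then have "h ?k = h' ?k" "F h = F h'" using \<open>n < N\<close> F(2) by (auto simp: prefix_fun_def)
    then show "F h (fst (h ?k)) (fst (snd (h ?k))) = F h' (fst (h' ?k)) (fst (snd (h' ?k)))" by simp
  qed
  have "(\<integral>\<^sup>+h. F h (fst (h ?k)) (fst (snd (h ?k))) \<partial>run \<theta> J) =
    (\<integral>\<^sup>+h. F h (fst (h ?k)) (fst (snd (h ?k))) \<partial>run \<theta> (Suc j))"
    using \<open>j < J\<close> by (intro nn_integral_run_prefix assms m pre) auto
  also have "\<dots> = (\<integral>\<^sup>+h. \<integral>\<^sup>+ob. F h (fst (ob n)) (fst (snd (ob n))) \<partial>agents \<theta> j h \<partial>run \<theta> j)"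
    by (subst nn_integral_run_Suc[OF assms(1) m])
      (simp add: upd_new \<open>n < N\<close> prefix_fun_upd[OF F(2)])
  also have "\<dots> = (\<integral>\<^sup>+h. avg (j * N) h (F h) \<partial>run \<theta> j)"
  proof (rule nn_integral_cong_AE, use AE_regular[OF assms(1)] in eventually_elim)
    fix h assume "regular (j * N) h"
    then have p: "prob_space (agent \<theta> (j * N) h)" by (rule prob_space_agent[OF assms(1)])
    have [measurable]: "(\<lambda>x. F h (fst x) (fst (snd x))) \<in> borel_measurable obsM"
      unfolding obsM_def by measurable
    have "(\<integral>\<^sup>+x. F h (fst x) (fst (snd x)) \<partial>agent \<theta> (j * N) h) =
      (\<integral>\<^sup>+x. F h (fst x) (fst (snd x)) \<partial>distr (agents \<theta> j h) (agent \<theta> (j * N) h) (\<lambda>ob. ob n))"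
      using \<open>n < N\<close> p unfolding agents_def by (subst distr_PiM_component) auto
    also have "\<dots> = (\<integral>\<^sup>+ob. F h (fst (ob n)) (fst (snd (ob n))) \<partial>agents \<theta> j h)"
      using \<open>n < N\<close> unfolding agents_def
      by (subst nn_integral_distr[OF measurable_component_singleton])
         (auto simp: measurable_cong_sets[OF sets_agent[OF assms(1)] refl])
    finally show "(\<integral>\<^sup>+ob. F h (fst (ob n)) (fst (snd (ob n))) \<partial>agents \<theta> j h) = avg (j * N) h (F h)"
      by (simp add: nn_integral_agent_avg[OF assms(1)])
  qed
  finally show ?thesis .
qed

text \<open>Given the past, the N agents are independent, so the product over one round integrates
  to a product of N factors at most 1. Batching the updates therefore costs nothing here.\<close>

lemma supermartingale:
  assumes "good \<theta>" and X[measurable]: "X \<in> borel_measurable obsM"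
    and le1: "\<And>m h. (\<integral>\<^sup>+x. X x \<partial>agent \<theta> m h) \<le> (1::ennreal)"
  shows "(\<integral>\<^sup>+h. (\<Prod>k<j * N. X (h k)) \<partial>run \<theta> j) \<le> 1"
proof (induction j)
  case 0
  then show ?case by simp
next
  case (Suc j)
  have "(\<integral>\<^sup>+h. (\<Prod>k<Suc j * N. X (h k)) \<partial>run \<theta> (Suc j)) =
     (\<integral>\<^sup>+h. \<integral>\<^sup>+ob. (\<Prod>k<Suc j * N. X (upd j h ob k)) \<partial>agents \<theta> j h \<partial>run \<theta> j)"
    by (rule nn_integral_run_Suc[OF assms(1)]) measurable
  also have "\<dots> = (\<integral>\<^sup>+h. (\<Prod>k<j * N. X (h k)) * (\<integral>\<^sup>+ob. (\<Prod>n<N. X (ob n)) \<partial>agents \<theta> j h) \<partial>run \<theta> j)"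
  proof (intro nn_integral_cong)
    fix h
    have "(\<lambda>ob. \<Prod>n<N. X (ob n)) \<in> borel_measurable (PiM {..<N} (\<lambda>_. obsM))"
      by (intro borel_measurable_prod_ennreal measurable_compose[OF measurable_component_singleton]) auto
    then have "(\<lambda>ob. \<Prod>n<N. X (ob n)) \<in> borel_measurable (agents \<theta> j h)"
      by (simp cong: measurable_cong_sets add: sets_agents assms(1))
    then show "(\<integral>\<^sup>+ob. (\<Prod>k<Suc j * N. X (upd j h ob k)) \<partial>agents \<theta> j h) =
      (\<Prod>k<j * N. X (h k)) * (\<integral>\<^sup>+ob. (\<Prod>n<N. X (ob n)) \<partial>agents \<theta> j h)"
      unfolding prod_upd by (rule nn_integral_cmult)
  qed
  also have "\<dots> \<le> (\<integral>\<^sup>+h. (\<Prod>k<j * N. X (h k)) * 1 \<partial>run \<theta> j)"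
  proof (intro nn_integral_mono mult_left_mono)
    fix h
    have "(\<integral>\<^sup>+ob. (\<Prod>n<N. X (ob n)) \<partial>agents \<theta> j h) = (\<Prod>n<N. \<integral>\<^sup>+x. X x \<partial>agent \<theta> (j * N) h)"
      unfolding agents_def
      by (rule nn_integral_PiM_prod)
        (auto simp: sigma_finite_agent assms(1) sets_agent[OF assms(1)] cong: measurable_cong_sets)
    also have "\<dots> \<le> (\<Prod>n<N. 1)" by (intro prod_mono_ennreal le1)
    finally show "(\<integral>\<^sup>+ob. (\<Prod>n<N. X (ob n)) \<partial>agents \<theta> j h) \<le> 1" by simp
  qed auto
  finally show ?case using Suc.IH by (simp only: mult_1_right)
qed

section \<open>Posterior samples and the true instance\<close>

definition slice :: "'s \<Rightarrow> ('s \<times> nat \<Rightarrow> real) \<Rightarrow> nat \<Rightarrow> real" where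
  "slice s \<theta> = (\<lambda>a\<in>{1..K}. \<theta> (s, a))"

lemma measurable_slice: "slice s \<in> prior \<rightarrow>\<^sub>M PiM {1..K} (\<lambda>_. borel)"
  unfolding slice_def[abs_def]
  by (intro measurable_restrict measurable_prior_component) (auto simp: arms_def)

text \<open>Bayes' rule for the sample in context s, multiplied through by the marginal density so
  that no quotient remains. \<open>slice\<close> gives the instance the type of a posterior sample,
  so that the same \<open>act\<close> computes the played and the optimal arm.\<close>

lemma posterior_slice:
  assumes fin: "marg m h < \<top>" and F[measurable]: "F \<in> borel_measurable (PiM {1..K} (\<lambda>_. borel))"
  shows "marg m h * (\<integral>\<^sup>+w. F w \<partial>postM m h s) =
    (\<integral>\<^sup>+\<theta>. ennreal (hist_dens m \<theta> h) * F (slice s \<theta>) \<partial>prior)"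
proof (cases "marg m h = 0")
  \<comment> \<open>The likelihood is then 0 for almost every instance, and both sides
    vanish.\<close>
  case True
  have "(\<lambda>\<theta>. ennreal (hist_dens m \<theta> h)) \<in> borel_measurable prior"
    using measurable_compose[OF measurable_Pair2' measurable_hist_dens, of h m] by simp
  then have "AE \<theta> in prior. ennreal (hist_dens m \<theta> h) = 0"
    using True unfolding marg_eq by (subst (asm) nn_integral_0_iff_AE)
  then have "(\<integral>\<^sup>+\<theta>. ennreal (hist_dens m \<theta> h) * F (slice s \<theta>) \<partial>prior) = (\<integral>\<^sup>+\<theta>. 0 \<partial>prior)"
    by (intro nn_integral_cong_AE) (auto elim: eventually_mono)
  with True show ?thesis by simp
next
  case False
  let ?P = "\<lambda>p. post m h (fst p) (snd p)"
  let ?e = "\<lambda>p. evid m h (fst p) (snd p)"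
  let ?d = "\<lambda>p v. ennreal (lik m h (fst p) (snd p) v) / ?e p"
  have "regular m h" using fin False by (simp add: regular_iff zero_less_iff_neq_zero)
  then have e: "0 < ?e p" "?e p < \<top>" if "p \<in> arms" for p
    using that by (auto simp: regular_def arms_def)
  then have P: "prob_space (?P p)" if "p \<in> arms" for p using that by (intro prob_space_post) auto
  have PiM_P: "PiM arms ?P = density prior (\<lambda>\<theta>. \<Prod>p\<in>arms. ?d p (\<theta> p))"
    unfolding prior_eq post_eq
    by (rule PiM_density) (auto simp: prior_prob prob_space_imp_sigma_finite P post_eq[symmetric] cong: measurable_cong_sets)
  have dm: "(\<lambda>\<theta>. \<Prod>p\<in>arms. ?d p (\<theta> p)) \<in> borel_measurable prior"
    by (intro borel_measurable_prod_ennreal) (auto intro!: measurable_compose[OF measurable_prior_component])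
  have Fs: "(\<lambda>\<theta>. F (slice s \<theta>)) \<in> borel_measurable prior"
    by (rule measurable_compose[OF measurable_slice F])
  \<comment> \<open>The posteriors of the other contexts are probability measures and integrate
    out.\<close>
  have "distr (PiM arms ?P) (PiM {1..K} (\<lambda>a. ?P (s, a))) (\<lambda>\<theta>. \<lambda>a\<in>{1..K}. \<theta> (s, a)) =
      PiM {1..K} (\<lambda>a. ?P (s, a))"
    by (rule distr_PiM_reindex[OF P]) (auto simp: inj_on_def arms_def)
  then have "postM m h s = distr (PiM arms ?P) (postM m h s) (slice s)"
    by (simp add: postM_def slice_def[abs_def])
  then have "(\<integral>\<^sup>+w. F w \<partial>postM m h s) = (\<integral>\<^sup>+w. F w \<partial>distr (PiM arms ?P) (postM m h s) (slice s))" by simp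
  also have "\<dots> = (\<integral>\<^sup>+\<theta>. F (slice s \<theta>) \<partial>PiM arms ?P)"
    by (rule nn_integral_distr)
      (use measurable_slice[of s] in \<open>simp_all add: PiM_P cong: measurable_cong_sets\<close>)
  also have "\<dots> = (\<integral>\<^sup>+\<theta>. (\<Prod>p\<in>arms. ?d p (\<theta> p)) * F (slice s \<theta>) \<partial>prior)"
    unfolding PiM_P by (rule nn_integral_density[OF dm Fs])
  finally have "marg m h * (\<integral>\<^sup>+w. F w \<partial>postM m h s) =
     (\<integral>\<^sup>+\<theta>. marg m h * ((\<Prod>p\<in>arms. ?d p (\<theta> p)) * F (slice s \<theta>)) \<partial>prior)"
    using dm Fs by (simp add: nn_integral_cmult)
  also have "\<dots> = (\<integral>\<^sup>+\<theta>. ennreal (hist_dens m \<theta> h) * F (slice s \<theta>) \<partial>prior)"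
  proof (intro nn_integral_cong)
    fix \<theta>
    have "marg m h * (\<Prod>p\<in>arms. ?d p (\<theta> p)) = (\<Prod>p\<in>arms. ennreal (lik m h (fst p) (snd p) (\<theta> p)))"
      unfolding marg_def prod.distrib[symmetric] ennreal_times_divide
    proof (intro prod.cong refl)
      fix p assume "p \<in> arms"
      from e[OF this] have "?e p \<noteq> 0" "?e p \<noteq> \<top>" by auto
      then show "?e p * ennreal (lik m h (fst p) (snd p) (\<theta> p)) / ?e p = ennreal (lik m h (fst p) (snd p) (\<theta> p))"
        by (metis mult.commute mult_divide_eq_ennreal)
    qed
    then show "marg m h * ((\<Prod>p\<in>arms. ?d p (\<theta> p)) * F (slice s \<theta>)) = ennreal (hist_dens m \<theta> h) * F (slice s \<theta>)"
      by (simp add: mult.assoc[symmetric] prod_ennreal lik_nonneg hist_dens_def)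
  qed
  finally show ?thesis .
qed

text \<open>Given the history, the sampled and the true optimal arm have the same distribution.\<close>
lemma thompson_matching:
  assumes F: "\<And>s a. (\<lambda>h. F h s a) \<in> borel_measurable histM"
  shows "(\<integral>\<^sup>+x. (\<Sum>s\<in>UNIV. ennreal (pmf PS s) * F (snd x) s (act (slice s (fst x)))) \<partial>joint j) =
     (\<integral>\<^sup>+x. avg (j * N) (snd x) (F (snd x)) \<partial>joint j)"
proof -
  have opt_meas: "(\<lambda>x. act (slice s (fst x))) \<in> prior \<Otimes>\<^sub>M histM \<rightarrow>\<^sub>M count_space UNIV" for s
    by (rule measurable_compose[OF measurable_fst measurable_compose[OF measurable_slice measurable_act]])
  have Fm: "(\<lambda>x. F (snd x) s (act (slice s (fst x)))) \<in> borel_measurable (prior \<Otimes>\<^sub>M histM)" for s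
    by (rule measurable_compose_countable'[where f="\<lambda>a x. F (snd x) s a" and I=UNIV, OF _ opt_meas])
       (auto intro: measurable_compose[OF measurable_snd F])
  have Fa: "(\<lambda>(h, w). F h s (act w)) \<in> borel_measurable (histM \<Otimes>\<^sub>M PiM {1..K} (\<lambda>_. borel))" for s
    unfolding split_beta'
    by (rule measurable_compose_countable'[where f="\<lambda>a x. F (fst x) s a" and I=UNIV and g="\<lambda>x. act (snd x)"])
       (auto intro: measurable_compose[OF measurable_fst F])
  have Im: "(\<lambda>h. \<integral>\<^sup>+w. F h s (act w) \<partial>postM (j * N) h s) \<in> borel_measurable histM" for s
    by (rule nn_integral_measurable_subprob_algebra2[OF Fa measurable_postM])
  have eq: "(\<integral>\<^sup>+x. F (snd x) s (act (slice s (fst x))) \<partial>joint j) =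
     (\<integral>\<^sup>+x. (\<integral>\<^sup>+w. F (snd x) s (act w) \<partial>postM (j * N) (snd x) s) \<partial>joint j)" for s
  proof -
    have "(\<integral>\<^sup>+x. F (snd x) s (act (slice s (fst x))) \<partial>joint j) =
      (\<integral>\<^sup>+h. \<integral>\<^sup>+\<theta>. ennreal (hist_dens (j * N) \<theta> h) * F h s (act (slice s \<theta>)) \<partial>prior \<partial>run ref j)"
      by (subst nn_integral_joint_ref[OF Fm]) simp
    also have "\<dots> = (\<integral>\<^sup>+h. marg (j * N) h * (\<integral>\<^sup>+w. F h s (act w) \<partial>postM (j * N) h s) \<partial>run ref j)"
    proof (rule nn_integral_cong_AE, use AE_marg_finite[of j] in eventually_elim)
      fix h assume "marg (j * N) h < \<top>"
      from posterior_slice[OF this, of "\<lambda>w. F h s (act w)" s]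
      show "(\<integral>\<^sup>+\<theta>. ennreal (hist_dens (j * N) \<theta> h) * F h s (act (slice s \<theta>)) \<partial>prior) =
         marg (j * N) h * (\<integral>\<^sup>+w. F h s (act w) \<partial>postM (j * N) h s)"
        by (simp add: measurable_compose[OF measurable_act])
    qed
    \<comment> \<open>Writing the marginal density back as an integral over the prior returns to the
      joint law, now with an integrand that depends on the history alone.\<close>
    also have "\<dots> = (\<integral>\<^sup>+h. \<integral>\<^sup>+\<theta>. ennreal (hist_dens (j * N) \<theta> h) * (\<integral>\<^sup>+w. F h s (act w) \<partial>postM (j * N) h s) \<partial>prior \<partial>run ref j)"
    proof (intro nn_integral_cong)
      fix h
      have "(\<lambda>\<theta>. ennreal (hist_dens (j * N) \<theta> h)) \<in> borel_measurable prior"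
        using measurable_compose[OF measurable_Pair2' measurable_hist_dens, of h "j * N"] by simp
      then show "marg (j * N) h * (\<integral>\<^sup>+w. F h s (act w) \<partial>postM (j * N) h s) =
         (\<integral>\<^sup>+\<theta>. ennreal (hist_dens (j * N) \<theta> h) * (\<integral>\<^sup>+w. F h s (act w) \<partial>postM (j * N) h s) \<partial>prior)"
        by (simp add: nn_integral_multc marg_eq)
    qed
    also have "\<dots> = (\<integral>\<^sup>+x. (\<integral>\<^sup>+w. F (snd x) s (act w) \<partial>postM (j * N) (snd x) s) \<partial>joint j)"
      by (subst nn_integral_joint_ref) (auto intro: measurable_compose[OF measurable_snd Im])
    finally show ?thesis .
  qed
  have Fm': "(\<lambda>x. F (snd x) s (act (slice s (fst x)))) \<in> borel_measurable (joint j)" 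
    "(\<lambda>x. \<integral>\<^sup>+w. F (snd x) s (act w) \<partial>postM (j * N) (snd x) s) \<in> borel_measurable (joint j)" for s
    using Fm measurable_compose[OF measurable_snd Im]
    by (simp_all cong: measurable_cong_sets)
  show ?thesis unfolding avg_def
    by (subst (1 2) nn_integral_sum) (auto intro!: borel_measurable_times_ennreal Fm' simp: nn_integral_cmult Fm' eq)
qed

section \<open>Concentration of the empirical means\<close>

text \<open>The 8 is that of Hoeffding's lemma for an interval of length 1. Negative l is reduced to
  positive l by negating the reward, which then lies in [-1, 0].\<close>

lemma hoeffding_rew:
  assumes "v \<in> \<Theta>"
  shows "(\<integral>\<^sup>+r. ennreal (exp (l * (r - mu v))) \<partial>rew v) \<le> ennreal (exp (l\<^sup>2 / 8))"
proof -
  interpret prob_space "rew v" by (rule prob_space_rew[OF assms])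
  consider "l > 0" | "l = 0" | "l < 0" by linarith
  then show ?thesis
  proof cases
    case 1
    interpret interval_bounded_random_variable "rew v" "\<lambda>r. r" 0 1
      by unfold_locales (use AE_rew in auto)
    show ?thesis using Hoeffdings_lemma_nn_integral[OF 1] by (simp add: ef_mean_def)
  next
    case 2
    then show ?thesis using emeasure_space_1 by simp
  next
    case 3
    interpret interval_bounded_random_variable "rew v" "\<lambda>r. - r" "-1" 0
      by unfold_locales (use AE_rew in auto)
    show ?thesis using Hoeffdings_lemma_nn_integral[of "- l"] 3
      by (simp add: ef_mean_def algebra_simps)
  qed
qed

definition cnt :: "nat \<Rightarrow> (nat \<Rightarrow> 's obs) \<Rightarrow> 's \<Rightarrow> nat \<Rightarrow> nat" where
  "cnt m h s a = card (pulls m h s a)"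

definition rsum :: "nat \<Rightarrow> (nat \<Rightarrow> 's obs) \<Rightarrow> 's \<Rightarrow> nat \<Rightarrow> real" where
  "rsum m h s a = (\<Sum>k\<in>pulls m h s a. snd (snd (h k)))"

lemma finite_pulls [simp]: "finite (pulls m h s a)"
  by (simp add: pulls_def)

lemma cnt_le: "cnt m h s a \<le> m"
  unfolding cnt_def pulls_def using card_mono[of "{..<m}" "{k. k < m \<and> fst (h k) = s \<and> fst (snd (h k)) = a}"] by auto

lemma sum_pulls: "(\<Sum>k\<in>pulls m h s a. F k) = (\<Sum>k<m. if fst (h k) = s \<and> fst (snd (h k)) = a then F k else 0)"
  unfolding pulls_def by (subst sum.inter_filter[symmetric]) (auto intro!: sum.cong)

lemma cnt_eq: "cnt m h s a = (\<Sum>k<m. if fst (h k) = s \<and> fst (snd (h k)) = a then 1 else 0)"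
  unfolding cnt_def card_eq_sum sum_pulls ..

lemma measurable_cnt [measurable (raw)]:
  assumes [measurable]: "H \<in> M \<rightarrow>\<^sub>M histM"
  shows "(\<lambda>x. cnt m (H x) s a) \<in> M \<rightarrow>\<^sub>M count_space UNIV"
  unfolding cnt_eq by measurable

lemma measurable_rsum [measurable (raw)]:
  assumes [measurable]: "H \<in> M \<rightarrow>\<^sub>M histM"
  shows "(\<lambda>x. rsum m (H x) s a) \<in> borel_measurable M"
  unfolding rsum_def sum_pulls by measurable

lemma prefix_pulls: "(\<forall>k<m. h k = h' k) \<Longrightarrow> pulls m h s a = pulls m h' s a"
  by (auto simp: pulls_def)

lemma prefix_cnt: "(\<forall>k<m. h k = h' k) \<Longrightarrow> cnt m h s a = cnt m h' s a"
  unfolding cnt_def using prefix_pulls by metis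

text \<open>Scaled by the count instead of divided by it: for an unplayed arm both sides are 0 and
  the strict inequality fails.\<close>

definition deviates :: "real \<Rightarrow> nat \<Rightarrow> ('s \<times> nat \<Rightarrow> real) \<Rightarrow> (nat \<Rightarrow> 's obs) \<Rightarrow> 's \<Rightarrow> nat \<Rightarrow> bool" where
  "deviates \<beta> m \<theta> h s a \<longleftrightarrow>
     \<beta> * sqrt (cnt m h s a) < \<bar>rsum m h s a - cnt m h s a * mu (\<theta> (s, a))\<bar>"

text \<open>One factor of the exponential supermartingale of a pair, compensated by Hoeffding's l^2
  / 8. The process moves only when the pair is pulled.\<close>

definition expw :: "real \<Rightarrow> real \<Rightarrow> 's \<Rightarrow> nat \<Rightarrow> 's obs \<Rightarrow> real" where
  "expw l c s a x = (if fst x = s \<and> fst (snd x) = a then exp (l * (snd (snd x) - c) - l\<^sup>2 / 8) else 1)"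

lemma measurable_expw [measurable]: "expw l c s a \<in> borel_measurable obsM"
  unfolding expw_def[abs_def] by measurable

lemma prod_expw:
  fixes l c :: real
  shows "(\<Prod>k<m. ennreal (expw l c s a (h k))) =
     ennreal (exp (l * (rsum m h s a - cnt m h s a * c) - l\<^sup>2 * cnt m h s a / 8))"
proof -
  have "(\<Prod>k<m. expw l c s a (h k)) = (\<Prod>k\<in>pulls m h s a. exp (l * (snd (snd (h k)) - c) - l\<^sup>2 / 8))"
    unfolding prod_pulls expw_def ..
  also have "\<dots> = exp (\<Sum>k\<in>pulls m h s a. l * (snd (snd (h k)) - c) - l\<^sup>2 / 8)"
    by (simp add: exp_sum)
  also have "(\<Sum>k\<in>pulls m h s a. l * (snd (snd (h k)) - c) - l\<^sup>2 / 8) =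
     l * (rsum m h s a - cnt m h s a * c) - l\<^sup>2 * cnt m h s a / 8"
    by (simp add: sum_subtractf sum_distrib_left[symmetric] rsum_def cnt_def)
  finally show ?thesis by (subst prod_ennreal) (auto simp: expw_def)
qed

lemma expw_supermartingale:
  assumes "good \<theta>" "a \<in> {1..K}"
  shows "(\<integral>\<^sup>+h. (\<Prod>k<j * N. ennreal (expw l (mu (\<theta> (s, a))) s a (h k))) \<partial>run \<theta> j) \<le> 1"
proof (rule supermartingale[OF assms(1)])
  let ?c = "mu (\<theta> (s, a))"
  show "(\<lambda>x. ennreal (expw l ?c s a x)) \<in> borel_measurable obsM" by measurable
  fix m h
  have inner: "(\<integral>\<^sup>+r. ennreal (expw l ?c s a (s', a', r)) \<partial>rew (\<theta> (s', a'))) \<le> 1" if "a' \<in> {1..K}" for s' a'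
  proof -
    have th: "\<theta> (s', a') \<in> \<Theta>" using assms(1) that by (auto simp: good_def)
    interpret prob_space "rew (\<theta> (s', a'))" by (rule prob_space_rew[OF th])
    show ?thesis
    proof (cases "s' = s \<and> a' = a")
      case True
      have "(\<integral>\<^sup>+r. ennreal (expw l ?c s a (s', a', r)) \<partial>rew (\<theta> (s', a'))) =
        (\<integral>\<^sup>+r. ennreal (exp (l * (r - ?c))) * ennreal (exp (- l\<^sup>2 / 8)) \<partial>rew (\<theta> (s, a)))"
        using True by (auto intro!: nn_integral_cong simp: expw_def ennreal_mult'[symmetric] exp_add[symmetric])
      also have "\<dots> = (\<integral>\<^sup>+r. ennreal (exp (l * (r - ?c))) \<partial>rew (\<theta> (s, a))) * ennreal (exp (- l\<^sup>2 / 8))"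
        by (rule nn_integral_multc) measurable
      also have "\<dots> \<le> ennreal (exp (l\<^sup>2 / 8)) * ennreal (exp (- l\<^sup>2 / 8))"
        using th True by (intro mult_right_mono hoeffding_rew) auto
      also have "\<dots> = 1" by (simp add: ennreal_mult'[symmetric] exp_add[symmetric])
      finally show ?thesis .
    next
      case False
      then show ?thesis using emeasure_space_1 by (auto simp: expw_def)
    qed
  qed
  have "(\<integral>\<^sup>+x. ennreal (expw l ?c s a x) \<partial>agent \<theta> m h) =
    (\<integral>\<^sup>+s'. \<integral>\<^sup>+w. \<integral>\<^sup>+r. ennreal (expw l ?c s a (s', act w, r)) \<partial>rew (\<theta> (s', act w)) \<partial>postM m h s' \<partial>measure_pmf PS)"
    by (rule nn_integral_agent[OF assms(1)]) measurable
  also have "\<dots> \<le> (\<integral>\<^sup>+s'. \<integral>\<^sup>+w. 1 \<partial>postM m h s' \<partial>measure_pmf PS)"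
    by (intro nn_integral_mono inner act_mem)
  also have "\<dots> \<le> (\<integral>\<^sup>+s'. 1 \<partial>measure_pmf PS)"
    by (intro nn_integral_mono) (simp add: subprob_space.emeasure_space_le_1[OF subprob_space_postM])
  also have "\<dots> = 1" by simp
  finally show "(\<integral>\<^sup>+x. ennreal (expw l ?c s a x) \<partial>agent \<theta> m h) \<le> 1" .
qed

text \<open>A Chernoff bound for a random number of pulls. At count n the exponent l \<beta> sqrt n
  - l^2 n / 8 is maximal for l = 4 \<beta> / sqrt n, with value 2 \<beta>^2. As the count is not
  known in advance, the bounds for n = 1, ..., j N and both signs of l are added, whence the factor
  2 j N.\<close>

lemma deviates_prob:
  assumes "good \<theta>" "a \<in> {1..K}" "\<beta> \<ge> 0"
  shows "(\<integral>\<^sup>+h. of_bool (deviates \<beta> (j * N) \<theta> h s a) \<partial>run \<theta> j) \<le> ennreal (2 * (j * N) * exp (- 2 * \<beta>\<^sup>2))"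
proof -
  define m where "m = j * N"
  define c where "c = mu (\<theta> (s, a))"
  define W where "W l h = ennreal (exp (- 2 * \<beta>\<^sup>2)) * (\<Prod>k<m. ennreal (expw l c s a (h k)))" for l h
  have W_meas [measurable]: "W l \<in> borel_measurable histM" for l
    unfolding W_def[abs_def] by measurable
  have W_int: "(\<integral>\<^sup>+h. W l h \<partial>run \<theta> j) \<le> ennreal (exp (- 2 * \<beta>\<^sup>2))" for l
  proof -
    have "(\<integral>\<^sup>+h. W l h \<partial>run \<theta> j) = ennreal (exp (- 2 * \<beta>\<^sup>2)) * (\<integral>\<^sup>+h. (\<Prod>k<m. ennreal (expw l c s a (h k))) \<partial>run \<theta> j)"
      unfolding W_def by (rule nn_integral_cmult) (unfold measurable_run_cong[OF assms(1)], measurable)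
    also have "\<dots> \<le> ennreal (exp (- 2 * \<beta>\<^sup>2)) * 1"
      unfolding m_def c_def by (intro mult_left_mono expw_supermartingale assms) auto
    finally show ?thesis by simp
  qed
  have key: "of_bool (deviates \<beta> m \<theta> h s a) \<le> (\<Sum>n\<in>{1..m}. W (4 * \<beta> / sqrt n) h + W (- 4 * \<beta> / sqrt n) h)" for h
  proof (cases "deviates \<beta> m \<theta> h s a")
    case True
    define n where "n = cnt m h s a"
    define D where "D = rsum m h s a - n * c"
    have D: "\<beta> * sqrt n < \<bar>D\<bar>" using True by (simp add: deviates_def D_def n_def c_def)
    have "n \<noteq> 0"
    proof
      assume "n = 0"
      then have "pulls m h s a = {}" by (simp add: n_def cnt_def)
      with D \<open>n = 0\<close> show False by (simp add: D_def rsum_def)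
    qed
    then have n: "n \<in> {1..m}" "sqrt n > 0" using cnt_le[of m h s a] by (auto simp: n_def)
    \<comment> \<open>With \<sigma> the sign of \<open>D\<close>, the linear part of the exponent is
      at least 4 \<beta>^2 and the quadratic part exactly 2 \<beta>^2, which offsets the prefactor
      of \<open>W\<close>.\<close>
    have W_ge: "1 \<le> W (\<sigma> * 4 * \<beta> / sqrt n) h" if "\<bar>D\<bar> = \<sigma> * D" "\<sigma>\<^sup>2 = 1" for \<sigma> :: real
    proof -
      let ?l = "\<sigma> * 4 * \<beta> / sqrt n"
      have "?l\<^sup>2 * n / 8 = 2 * \<beta>\<^sup>2"
        using n that by (simp add: power_mult_distrib power_divide)
      moreover have "?l * D = 4 * \<beta> / sqrt n * \<bar>D\<bar>" using that(1) by simp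
      moreover have "4 * \<beta> / sqrt n * \<bar>D\<bar> \<ge> 4 * \<beta> / sqrt n * (\<beta> * sqrt n)"
        using D n assms(3) by (intro mult_left_mono) auto
      moreover have "4 * \<beta> / sqrt n * (\<beta> * sqrt n) = 4 * \<beta>\<^sup>2"
        using n by (simp add: power2_eq_square)
      ultimately have "0 \<le> - 2 * \<beta>\<^sup>2 + (?l * D - ?l\<^sup>2 * n / 8)" by linarith
      then have "1 \<le> exp (- 2 * \<beta>\<^sup>2) * exp (?l * D - ?l\<^sup>2 * n / 8)"
        by (simp only: exp_add[symmetric] one_le_exp_iff)
      then show ?thesis
        unfolding W_def prod_expw n_def[symmetric] D_def[symmetric]
          by (subst ennreal_mult'[symmetric]) (simp_all add: ennreal_ge_1)
    qed
    have "1 \<le> W (4 * \<beta> / sqrt n) h + W (- 4 * \<beta> / sqrt n) h"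
    proof (cases "D \<ge> 0")
      case True
      then have "1 \<le> W (4 * \<beta> / sqrt n) h" using W_ge[of 1] by simp
      then show ?thesis by (rule order_trans) simp
    next
      case False
      then have "1 \<le> W (- 4 * \<beta> / sqrt n) h" using W_ge[of "- 1"] by simp
      then show ?thesis by (rule order_trans) simp
    qed
    also have "\<dots> \<le> (\<Sum>n\<in>{1..m}. W (4 * \<beta> / sqrt n) h + W (- 4 * \<beta> / sqrt n) h)"
      using n by (intro member_le_sum[where f="\<lambda>n. W (4 * \<beta> / sqrt (real n)) h + W (- 4 * \<beta> / sqrt (real n)) h"]) auto
    finally show ?thesis by simp
  qed simp
  have "(\<integral>\<^sup>+h. of_bool (deviates \<beta> m \<theta> h s a) \<partial>run \<theta> j) \<le>
     (\<integral>\<^sup>+h. (\<Sum>n\<in>{1..m}. W (4 * \<beta> / sqrt n) h + W (- 4 * \<beta> / sqrt n) h) \<partial>run \<theta> j)"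
    by (intro nn_integral_mono key)
  also have "\<dots> = (\<Sum>n\<in>{1..m}. (\<integral>\<^sup>+h. W (4 * \<beta> / sqrt n) h \<partial>run \<theta> j) + (\<integral>\<^sup>+h. W (- 4 * \<beta> / sqrt n) h \<partial>run \<theta> j))"
    by (simp add: nn_integral_sum nn_integral_add measurable_run_cong assms(1))
  also have "\<dots> \<le> (\<Sum>n\<in>{1..m}. ennreal (exp (- 2 * \<beta>\<^sup>2)) + ennreal (exp (- 2 * \<beta>\<^sup>2)))"
    by (intro sum_mono add_mono W_int)
  also have "\<dots> = ennreal (2 * m * exp (- 2 * \<beta>\<^sup>2))"
    by (simp add: ennreal_plus[symmetric] ennreal_of_nat_eq_real_of_nat ennreal_mult'[symmetric] del: ennreal_plus)
  finally show ?thesis unfolding m_def by simp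
qed

definition bad :: "real \<Rightarrow> nat \<Rightarrow> ('s \<times> nat \<Rightarrow> real) \<Rightarrow> (nat \<Rightarrow> 's obs) \<Rightarrow> bool" where
  "bad \<beta> m \<theta> h \<longleftrightarrow> (\<exists>p\<in>arms. deviates \<beta> m \<theta> h (fst p) (snd p))"

text \<open>Off \<open>arms\<close> all points of the extensional product take the value
  \<open>undefined\<close>, so such a coordinate is constant. Later measurability proofs can then
  range over all arm numbers.\<close>

lemma measurable_prior_component': "(\<lambda>\<theta>. \<theta> p) \<in> borel_measurable prior"
proof (cases "p \<in> arms")
  case False
  have "space prior = space (PiM arms (\<lambda>_. borel))" by (rule sets_eq_imp_space_eq[OF sets_prior])
  then have "\<theta> p = undefined" if "\<theta> \<in> space prior" for \<theta>
    using that False by (simp only: space_PiM PiE_def extensional_def) blast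
  then show ?thesis by (subst measurable_cong[where g="\<lambda>_. undefined"]) auto
qed (rule measurable_prior_component)

lemma measurable_bad [measurable]:
  "Measurable.pred (prior \<Otimes>\<^sub>M histM) (\<lambda>x. bad \<beta> m (fst x) (snd x))"
  unfolding bad_def deviates_def
proof (intro pred_intros_finite finite_arms)
  fix p :: "'s \<times> nat"
  have [measurable]: "(\<lambda>x. mu (fst x (fst p, snd p))) \<in> borel_measurable (prior \<Otimes>\<^sub>M histM)"
    by (intro measurable_compose[OF measurable_fst] measurable_compose[OF measurable_prior_component' measurable_mu])
  show "Measurable.pred (prior \<Otimes>\<^sub>M histM) (\<lambda>x. \<beta> * sqrt (cnt m (snd x) (fst p) (snd p))
     < \<bar>rsum m (snd x) (fst p) (snd p) - cnt m (snd x) (fst p) (snd p) * mu (fst x (fst p, snd p))\<bar>)"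
    by measurable
qed

lemma bad_prob:
  assumes "\<beta> \<ge> 0"
  shows "(\<integral>\<^sup>+x. of_bool (bad \<beta> (j * N) (fst x) (snd x)) \<partial>joint j) \<le>
    ennreal (2 * CARD('s) * K * (j * N) * exp (- 2 * \<beta>\<^sup>2))"
proof -
  let ?B = "2 * (j * N) * exp (- 2 * \<beta>\<^sup>2)"
  have dev_meas: "(\<lambda>h. of_bool (deviates \<beta> (j * N) \<theta> h s a) :: ennreal) \<in> borel_measurable histM" for \<theta> s a
    unfolding deviates_def by measurable
  have "(\<integral>\<^sup>+x. of_bool (bad \<beta> (j * N) (fst x) (snd x)) \<partial>joint j) =
     (\<integral>\<^sup>+\<theta>. \<integral>\<^sup>+h. of_bool (bad \<beta> (j * N) \<theta> h) \<partial>run \<theta> j \<partial>prior)"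
    by (subst nn_integral_joint) auto
  also have "\<dots> \<le> (\<integral>\<^sup>+\<theta>. ennreal (card arms * ?B) \<partial>prior)"
  proof (rule nn_integral_mono_AE, use AE_prior_good in eventually_elim)
    fix \<theta> assume g: "good \<theta>"
    have "(\<integral>\<^sup>+h. of_bool (bad \<beta> (j * N) \<theta> h) \<partial>run \<theta> j) \<le>
      (\<integral>\<^sup>+h. (\<Sum>p\<in>arms. of_bool (deviates \<beta> (j * N) \<theta> h (fst p) (snd p))) \<partial>run \<theta> j)"
    proof (intro nn_integral_mono)
      fix h
      show "of_bool (bad \<beta> (j * N) \<theta> h) \<le> (\<Sum>p\<in>arms. of_bool (deviates \<beta> (j * N) \<theta> h (fst p) (snd p)) :: ennreal)"
      proof (cases "bad \<beta> (j * N) \<theta> h")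
        case True
        then obtain p where p: "p \<in> arms" "deviates \<beta> (j * N) \<theta> h (fst p) (snd p)" by (auto simp: bad_def)
        then have "(1::ennreal) = of_bool (deviates \<beta> (j * N) \<theta> h (fst p) (snd p))" by simp
        also have "\<dots> \<le> (\<Sum>p\<in>arms. of_bool (deviates \<beta> (j * N) \<theta> h (fst p) (snd p)))"
          using p by (intro member_le_sum) auto
        finally show ?thesis by simp
      qed simp
    qed
    also have "\<dots> = (\<Sum>p\<in>arms. \<integral>\<^sup>+h. of_bool (deviates \<beta> (j * N) \<theta> h (fst p) (snd p)) \<partial>run \<theta> j)"
      by (rule nn_integral_sum) (simp add: measurable_run_cong[OF g] dev_meas)
    also have "\<dots> \<le> (\<Sum>p\<in>arms. ennreal ?B)"
      by (intro sum_mono deviates_prob g assms) (auto simp: arms_def)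
    also have "\<dots> = ennreal (card arms * ?B)"
      by (simp add: ennreal_of_nat_eq_real_of_nat ennreal_mult'[symmetric])
    finally show "(\<integral>\<^sup>+h. of_bool (bad \<beta> (j * N) \<theta> h) \<partial>run \<theta> j) \<le> ennreal (card arms * ?B)" .
  qed
  also have "\<dots> = ennreal (card arms * ?B)"
    using prob_space.emeasure_space_1[OF prob_space_prior] by simp
  finally show ?thesis by (simp add: arms_def card_cartesian_product mult.assoc mult.left_commute)
qed

section \<open>Upper confidence bounds\<close>

definition ucb :: "real \<Rightarrow> nat \<Rightarrow> (nat \<Rightarrow> 's obs) \<Rightarrow> 's \<Rightarrow> nat \<Rightarrow> real" where
  "ucb \<beta> m h s a = (if cnt m h s a = 0 then 1
     else max 0 (min 1 (rsum m h s a / cnt m h s a + \<beta> / sqrt (cnt m h s a))))"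

definition width :: "real \<Rightarrow> nat \<Rightarrow> real" where
  "width \<beta> c = (if c = 0 then 1 else min 1 (2 * \<beta> / sqrt c))"

lemma measurable_ucb [measurable (raw)]:
  assumes [measurable]: "H \<in> M \<rightarrow>\<^sub>M histM"
  shows "(\<lambda>x. ucb \<beta> m (H x) s a) \<in> borel_measurable M"
  unfolding ucb_def by measurable

lemma ucb_range: "0 \<le> ucb \<beta> m h s a" "ucb \<beta> m h s a \<le> 1"
  by (auto simp: ucb_def)

lemma width_nonneg: "\<beta> \<ge> 0 \<Longrightarrow> 0 \<le> width \<beta> c"
  by (simp add: width_def)

text \<open>The empirical mean errs by at most one radius and the bound adds another, hence the
  factor 2 in \<open>width\<close>. The true mean lies in [0, 1], so clipping to this interval
  preserves both inequalities and allows capping the width at 1; an untried arm has bound and width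
  1.\<close>

lemma ucb_bounds:
  assumes "good \<theta>" "a \<in> {1..K}" "\<not> bad \<beta> m \<theta> h"
  shows "mu (\<theta> (s, a)) \<le> ucb \<beta> m h s a" "ucb \<beta> m h s a \<le> mu (\<theta> (s, a)) + width \<beta> (cnt m h s a)"
proof -
  define c where "c = mu (\<theta> (s, a))"
  define n where "n = cnt m h s a"
  define e where "e = rsum m h s a / n"
  have c: "c \<in> {0..1}" unfolding c_def using assms by (intro mu_range) (auto simp: good_def)
  have "mu (\<theta> (s, a)) \<le> ucb \<beta> m h s a \<and> ucb \<beta> m h s a \<le> mu (\<theta> (s, a)) + width \<beta> (cnt m h s a)"
  proof (cases "n = 0")
    case True
    then show ?thesis using c by (auto simp: ucb_def width_def n_def c_def)
  next
    case False
    have "\<not> deviates \<beta> m \<theta> h s a" using assms by (auto simp: bad_def arms_def)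
    then have "\<bar>rsum m h s a - n * c\<bar> \<le> \<beta> * sqrt n" by (simp add: deviates_def n_def c_def)
    moreover have "rsum m h s a = e * n" using False by (simp add: e_def)
    moreover from this have "(e - c) * n = rsum m h s a - n * c" by (simp add: left_diff_distrib)
    ultimately have "\<bar>(e - c) * n\<bar> \<le> \<beta> * sqrt n" by simp
    then have "\<bar>e - c\<bar> * n \<le> \<beta> * sqrt n" by (simp add: abs_mult)
    also have "\<beta> * sqrt n = (\<beta> / sqrt n) * n" using False by (simp add: eq_divide_eq mult.assoc)
    finally have w: "\<bar>e - c\<bar> \<le> \<beta> / sqrt n"
      by (rule mult_right_le_imp_le) (use False in simp)
    have 1: "ucb \<beta> m h s a = max 0 (min 1 (e + \<beta> / sqrt n))"
      using False by (simp add: ucb_def n_def e_def)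
    have 2: "width \<beta> (cnt m h s a) = min 1 (2 * (\<beta> / sqrt n))"
      using False by (simp add: width_def n_def)
    show ?thesis unfolding 1 2 c_def[symmetric] using clip_bounds[OF w] c by simp
  qed
  then show "mu (\<theta> (s, a)) \<le> ucb \<beta> m h s a" "ucb \<beta> m h s a \<le> mu (\<theta> (s, a)) + width \<beta> (cnt m h s a)"
    by auto
qed

section \<open>Regret of a single round\<close>

text \<open>Lets integrands be compared only where all posteriors are genuine, in particular where
  \<open>avg\<close> fixes constants.\<close>

lemma joint_mono:
  assumes F: "F \<in> borel_measurable (prior \<Otimes>\<^sub>M histM)" and G: "G \<in> borel_measurable (prior \<Otimes>\<^sub>M histM)"
    and le: "\<And>\<theta> h. good \<theta> \<Longrightarrow> regular (j * N) h \<Longrightarrow> F (\<theta>, h) \<le> G (\<theta>, h)"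
  shows "(\<integral>\<^sup>+x. F x \<partial>joint j) \<le> (\<integral>\<^sup>+x. G x \<partial>joint j)"
  unfolding nn_integral_joint[OF F] nn_integral_joint[OF G]
proof (rule nn_integral_mono_AE, use AE_prior_good in eventually_elim)
  fix \<theta> assume g: "good \<theta>"
  show "(\<integral>\<^sup>+h. F (\<theta>, h) \<partial>run \<theta> j) \<le> (\<integral>\<^sup>+h. G (\<theta>, h) \<partial>run \<theta> j)"
    using AE_regular[OF g, of j] by (intro nn_integral_mono_AE) (auto elim!: eventually_mono intro: le g)
qed

lemma measurable_avg:
  assumes f: "\<And>s a. (\<lambda>x. f x s a) \<in> borel_measurable (prior \<Otimes>\<^sub>M histM)"
  shows "(\<lambda>x. avg m (snd x) (f x)) \<in> borel_measurable (prior \<Otimes>\<^sub>M histM)"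
  unfolding avg_def
proof (intro borel_measurable_sum borel_measurable_times_ennreal borel_measurable_const)
  fix s
  have fm: "(\<lambda>(x, w). f x s (act w)) \<in> borel_measurable ((prior \<Otimes>\<^sub>M histM) \<Otimes>\<^sub>M PiM {1..K} (\<lambda>_. borel))"
    unfolding split_beta'
    by (rule measurable_compose_countable'[where f="\<lambda>a x. f (fst x) s a" and I=UNIV and g="\<lambda>x. act (snd x)"])
       (auto intro: measurable_compose[OF measurable_fst f])
  show "(\<lambda>x. \<integral>\<^sup>+w. f x s (act w) \<partial>postM m (snd x) s) \<in> borel_measurable (prior \<Otimes>\<^sub>M histM)"
    by (rule nn_integral_measurable_subprob_algebra2[OF fm measurable_compose[OF measurable_snd measurable_postM]])
qed

lemma measurable_entry:
  fixes f :: "('s \<times> nat \<Rightarrow> real) \<times> (nat \<Rightarrow> 's obs) \<Rightarrow> 's \<Rightarrow> nat \<Rightarrow> ennreal"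
  assumes f: "\<And>s a. (\<lambda>x. f x s a) \<in> borel_measurable (prior \<Otimes>\<^sub>M histM)"
  shows "(\<lambda>x. f x (fst (snd x k)) (fst (snd (snd x k)))) \<in> borel_measurable (prior \<Otimes>\<^sub>M histM)"
proof -
  have 1: "(\<lambda>x. fst (snd x k)) \<in> prior \<Otimes>\<^sub>M histM \<rightarrow>\<^sub>M count_space UNIV"
    "(\<lambda>x. fst (snd (snd x k))) \<in> prior \<Otimes>\<^sub>M histM \<rightarrow>\<^sub>M count_space UNIV"
    by (rule measurable_compose[OF measurable_snd], measurable)+
  have "(\<lambda>x. f x (fst (snd x k)) a) \<in> borel_measurable (prior \<Otimes>\<^sub>M histM)" for a
    by (rule measurable_compose_countable'[where f="\<lambda>s x. f x s a" and I=UNIV, OF f 1(1)]) auto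
  then show ?thesis
    by (rule measurable_compose_countable'[where f="\<lambda>a x. f x (fst (snd x k)) a" and I=UNIV, OF _ 1(2)]) auto
qed

text \<open>Translates between an entry of the complete run and the policy average at the start of
  its round: the regret analysis needs the latter, the summation of the widths the former.\<close>

lemma nn_integral_joint_entry:
  assumes f: "\<And>s a. (\<lambda>x. f x s a) \<in> borel_measurable (prior \<Otimes>\<^sub>M histM)"
    and pre: "\<And>\<theta>. prefix_fun (j * N) (\<lambda>h. f (\<theta>, h))" and "j < J" "n < N"
  shows "(\<integral>\<^sup>+x. f x (fst (snd x (j * N + n))) (fst (snd (snd x (j * N + n)))) \<partial>joint J) =
    (\<integral>\<^sup>+x. avg (j * N) (snd x) (f x) \<partial>joint j)"
proof -
  have "(\<integral>\<^sup>+h. f (\<theta>, h) (fst (h (j * N + n))) (fst (snd (h (j * N + n)))) \<partial>run \<theta> J) =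
      (\<integral>\<^sup>+h. avg (j * N) h (f (\<theta>, h)) \<partial>run \<theta> j)" if "good \<theta>" "\<theta> \<in> space prior" for \<theta>
    using f that by (intro nn_integral_run_entry pre assms) auto
  then have "(\<integral>\<^sup>+\<theta>. \<integral>\<^sup>+h. f (\<theta>, h) (fst (h (j * N + n))) (fst (snd (h (j * N + n)))) \<partial>run \<theta> J \<partial>prior) =
      (\<integral>\<^sup>+\<theta>. \<integral>\<^sup>+h. avg (j * N) h (f (\<theta>, h)) \<partial>run \<theta> j \<partial>prior)"
    using AE_prior_good AE_space[of prior] by (intro nn_integral_cong_AE) (auto elim: eventually_elim2)
  moreover have "(\<lambda>x. f x (fst (snd x (j * N + n))) (fst (snd (snd x (j * N + n))))) \<in> borel_measurable (prior \<Otimes>\<^sub>M histM)"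
    by (rule measurable_entry[OF f])
  ultimately show ?thesis
    using nn_integral_joint[OF measurable_avg[OF f], of j "j * N"] by (subst nn_integral_joint) simp_all
qed

definition opt :: "('s \<times> nat \<Rightarrow> real) \<Rightarrow> 's \<Rightarrow> real" where
  "opt \<theta> s = mu (\<theta> (s, act (slice s \<theta>)))"

definition regr :: "('s \<times> nat \<Rightarrow> real) \<Rightarrow> 's \<Rightarrow> nat \<Rightarrow> real" where
  "regr \<theta> s a = opt \<theta> s - mu (\<theta> (s, a))"

lemma opt_eq: "opt \<theta> s = (MAX c\<in>{1..K}. mu (\<theta> (s, c)))"
proof -
  have "act (slice s \<theta>) = greedy K (\<lambda>c. mu (\<theta> (s, c)))"
    unfolding act_def by (rule greedy_cong) (simp add: slice_def)
  then show ?thesis by (simp add: opt_def Max_greedy[OF K_pos])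
qed

lemma mu_good: "good \<theta> \<Longrightarrow> a \<in> {1..K} \<Longrightarrow> 0 \<le> mu (\<theta> (s, a)) \<and> mu (\<theta> (s, a)) \<le> 1"
  using mu_range[of "\<theta> (s, a)"] by (auto simp: good_def)

lemma regr_good: "good \<theta> \<Longrightarrow> a \<in> {1..K} \<Longrightarrow> 0 \<le> regr \<theta> s a \<and> regr \<theta> s a \<le> 1"
proof -
  assume g: "good \<theta>" and a: "a \<in> {1..K}"
  have "mu (\<theta> (s, a)) \<le> opt \<theta> s"
    unfolding opt_eq using a by (intro Max_ge) auto
  then show ?thesis
    using mu_good[OF g a, of s] mu_good[OF g act_mem, of s "slice s \<theta>"] by (simp add: regr_def opt_def)
qed

lemma measurable_mu_prior [measurable]: "(\<lambda>\<theta>. mu (\<theta> p)) \<in> borel_measurable prior"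
  by (rule measurable_compose[OF measurable_prior_component' measurable_mu])

lemma measurable_opt [measurable]: "(\<lambda>\<theta>. opt \<theta> s) \<in> borel_measurable prior"
proof -
  have "(\<lambda>\<theta>. act (slice s \<theta>)) \<in> prior \<rightarrow>\<^sub>M count_space UNIV"
    by (rule measurable_compose[OF measurable_slice measurable_act])
  then show ?thesis unfolding opt_def
    by (rule measurable_compose_countable'[where f="\<lambda>a \<theta>. mu (\<theta> (s, a))" and I=UNIV, rotated]) auto
qed

lemma measurable_regr: "(\<lambda>x. ennreal (regr (fst x) s a)) \<in> borel_measurable (prior \<Otimes>\<^sub>M histM)"
proof -
  have "(\<lambda>\<theta>. ennreal (regr \<theta> s a)) \<in> borel_measurable prior" unfolding regr_def by measurable
  then show ?thesis by (rule measurable_compose[OF measurable_fst])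
qed

text \<open>Out-of-range arms, which are never played, are given width 0 so that the widths can be
  summed over all histories.\<close>
definition arm_width :: "real \<Rightarrow> nat \<Rightarrow> (nat \<Rightarrow> 's obs) \<Rightarrow> 's \<Rightarrow> nat \<Rightarrow> real" where
  "arm_width \<beta> m h s a = (if a \<in> {1..K} then width \<beta> (cnt m h s a) else 0)"

lemma prefix_arm_width: "prefix_fun m (\<lambda>h s a. ennreal (arm_width \<beta> m h s a))"
  unfolding prefix_fun_def arm_width_def using prefix_cnt by metis

lemma measurable_arm_width [measurable (raw)]:
  assumes [measurable]: "H \<in> M \<rightarrow>\<^sub>M histM"
  shows "(\<lambda>x. arm_width \<beta> m (H x) s a) \<in> borel_measurable M"
  unfolding arm_width_def width_def by measurable

text \<open>Russo and Van Roy's decomposition: since the upper confidence bound depends on the history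
  only, its values at the sampled and at the optimal arm agree in expectation.\<close>
lemma round_regret:
  assumes "\<beta> \<ge> 0" "j < J" "n < N"
  defines "k \<equiv> j * N + n"
  shows "(\<integral>\<^sup>+x. ennreal (regr (fst x) (fst (snd x k)) (fst (snd (snd x k)))) \<partial>joint J) \<le>
    (\<integral>\<^sup>+x. ennreal (arm_width \<beta> (j * N) (snd x) (fst (snd x k)) (fst (snd (snd x k)))) \<partial>joint J) +
    ennreal (4 * CARD('s) * K * (j * N) * exp (- 2 * \<beta>\<^sup>2))"
proof -
  define m where "m = j * N"
  let ?B = "\<lambda>x. of_bool (bad \<beta> m (fst x) (snd x)) :: ennreal"
  let ?U = "\<lambda>h s a. ennreal (ucb \<beta> m h s a)"
  let ?R = "\<lambda>x s a. ennreal (regr (fst x) s a)"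
  let ?M = "\<lambda>x s a. ennreal (mu (fst x (s, a)))"
  let ?W = "\<lambda>x s a. ennreal (arm_width \<beta> m (snd x) s a)"
  let ?P = "\<integral>\<^sup>+x. ?B x \<partial>joint j"
  let ?opt = "\<lambda>x. \<Sum>s\<in>UNIV. ennreal (pmf PS s) * ?U (snd x) s (act (slice s (fst x)))"
  have Mm: "(\<lambda>x. ?M x s a) \<in> borel_measurable (prior \<Otimes>\<^sub>M histM)" for s a
    using measurable_compose[OF measurable_fst measurable_mu_prior] by measurable
  have Wm: "(\<lambda>x. ?W x s a) \<in> borel_measurable (prior \<Otimes>\<^sub>M histM)" for s a by measurable
  have Bm: "?B \<in> borel_measurable (prior \<Otimes>\<^sub>M histM)" by measurable
  have Um: "(\<lambda>x. ?U (snd x) s a) \<in> borel_measurable (prior \<Otimes>\<^sub>M histM)" for s a by measurable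
  have opt_meas: "(\<lambda>x. act (slice s (fst x))) \<in> prior \<Otimes>\<^sub>M histM \<rightarrow>\<^sub>M count_space UNIV" for s
    by (rule measurable_compose[OF measurable_fst measurable_compose[OF measurable_slice measurable_act]])
  have Om: "?opt \<in> borel_measurable (prior \<Otimes>\<^sub>M histM)"
    by (intro borel_measurable_sum borel_measurable_times_ennreal borel_measurable_const
      measurable_compose_countable'[where f="\<lambda>a x. ?U (snd x) s a" and I=UNIV for s, OF Um opt_meas]) auto
  note Ra = measurable_avg[OF measurable_regr, of m] and Ma = measurable_avg[OF Mm, of m]
    and Wa = measurable_avg[OF Wm, of m] and Ua = measurable_avg[OF Um, of m]
  note J = measurable_cong_sets[OF sets_joint refl]
  \<comment> \<open>The expected mean reward of the played arm is finite, so it can be cancelled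
    below; this replaces a subtraction in \<open>ennreal\<close>.\<close>
  have "(\<integral>\<^sup>+x. avg m (snd x) (?M x) \<partial>joint j) \<le> (\<integral>\<^sup>+x. 1 \<partial>joint j)"
  proof (rule joint_mono[OF Ma])
    fix \<theta> h assume g: "good \<theta>" and r: "regular (j * N) h"
    have "avg m h (?M (\<theta>, h)) \<le> avg m h (\<lambda>s a. 1)"
      using mu_good[OF g] by (intro avg_mono) (simp add: ennreal_le_1)
    also have "\<dots> = 1" using avg_const[OF r, of "\<lambda>_. 1"] by (simp add: sum_pmf_PS m_def)
    finally show "avg m (snd (\<theta>, h)) (?M (\<theta>, h)) \<le> 1" by simp
  qed simp
  then have fin: "(\<integral>\<^sup>+x. avg m (snd x) (?M x) \<partial>joint j) \<noteq> \<infinity>"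
    using joint_le_1[of j] by (auto simp: top_unique)
  have "(\<integral>\<^sup>+x. avg m (snd x) (?M x) \<partial>joint j) + (\<integral>\<^sup>+x. avg m (snd x) (?R x) \<partial>joint j) =
    (\<integral>\<^sup>+x. avg m (snd x) (?M x) + avg m (snd x) (?R x) \<partial>joint j)"
    using Ra Ma by (subst nn_integral_add) (simp_all add: J)
  \<comment> \<open>Optimism at the optimal arm: outside the bad event its mean is below its
    confidence bound, and on the bad event it is at most 1, which the indicator pays.\<close>
  also have "\<dots> \<le> (\<integral>\<^sup>+x. ?opt x + ?B x \<partial>joint j)"
  proof (rule joint_mono)
    fix \<theta> h assume g: "good \<theta>" and r: "regular (j * N) h"
    have "avg m h (?M (\<theta>, h)) + avg m h (?R (\<theta>, h)) = avg m h (\<lambda>s a. ?M (\<theta>, h) s a + ?R (\<theta>, h) s a)"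
      by (simp add: avg_add)
    also have "\<dots> \<le> avg m h (\<lambda>s a. ennreal (opt \<theta> s))"
    proof (rule avg_mono)
      fix s a assume a: "a \<in> {1..K}"
      show "?M (\<theta>, h) s a + ?R (\<theta>, h) s a \<le> ennreal (opt \<theta> s)"
        using mu_good[OF g a, of s] regr_good[OF g a, of s]
        by (simp add: ennreal_plus[symmetric] regr_def del: ennreal_plus)
    qed
    also have "\<dots> = (\<Sum>s\<in>UNIV. ennreal (pmf PS s) * ennreal (opt \<theta> s))"
      using r by (simp add: avg_const m_def)
    also have "\<dots> \<le> (\<Sum>s\<in>UNIV. ennreal (pmf PS s) * (?U h s (act (slice s \<theta>)) + ?B (\<theta>, h)))"
    proof (intro sum_mono mult_left_mono)
      fix s
      show "ennreal (opt \<theta> s) \<le> ?U h s (act (slice s \<theta>)) + ?B (\<theta>, h)"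
      proof (cases "bad \<beta> m \<theta> h")
        case True
        have "ennreal (opt \<theta> s) \<le> 1"
          using mu_good[OF g act_mem, of s "slice s \<theta>"] by (simp add: opt_def ennreal_le_1)
        then show ?thesis using True by (simp add: add_increasing)
      next
        case False
        then show ?thesis
          using ucb_bounds(1)[OF g act_mem False, of s "slice s \<theta>"] by (simp add: opt_def ennreal_leI)
      qed
    qed simp
    also have "\<dots> = ?opt (\<theta>, h) + ?B (\<theta>, h)"
      by (simp add: distrib_left sum.distrib sum_distrib_right[symmetric] sum_pmf_PS)
    finally show "avg m (snd (\<theta>, h)) (?M (\<theta>, h)) + avg m (snd (\<theta>, h)) (?R (\<theta>, h)) \<le> ?opt (\<theta>, h) + ?B (\<theta>, h)"
      by simp
  qed (use Ra Ma Om Bm in \<open>simp_all\<close>)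
  also have "\<dots> = (\<integral>\<^sup>+x. ?opt x \<partial>joint j) + ?P"
    using Om Bm by (subst nn_integral_add) (simp_all add: J)
  also have "(\<integral>\<^sup>+x. ?opt x \<partial>joint j) = (\<integral>\<^sup>+x. avg m (snd x) (?U (snd x)) \<partial>joint j)"
    unfolding m_def by (rule thompson_matching) measurable
  \<comment> \<open>At the played arm the confidence bound exceeds the mean by at most the width. On
    the bad event the clipped bound is at most 1, so the indicator pays a second time.\<close>
  also have "\<dots> \<le> (\<integral>\<^sup>+x. avg m (snd x) (?M x) + avg m (snd x) (?W x) + ?B x \<partial>joint j)"
  proof (rule joint_mono)
    fix \<theta> h assume g: "good \<theta>" and r: "regular (j * N) h"
    have "avg m h (?U h) \<le> avg m h (\<lambda>s a. ?M (\<theta>, h) s a + ?W (\<theta>, h) s a + ?B (\<theta>, h))"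
    proof (rule avg_mono)
      fix s a assume a: "a \<in> {1..K}"
      show "?U h s a \<le> ?M (\<theta>, h) s a + ?W (\<theta>, h) s a + ?B (\<theta>, h)"
      proof (cases "bad \<beta> m \<theta> h")
        case True
        have "?U h s a \<le> 1" using ucb_range by (simp add: ennreal_le_1)
        then show ?thesis using True by (simp add: add_increasing)
      next
        case False
        have "?U h s a \<le> ennreal (mu (\<theta> (s, a)) + width \<beta> (cnt m h s a))"
          by (intro ennreal_leI ucb_bounds g a False)
        then show ?thesis using False a mu_good[OF g a, of s] width_nonneg[OF assms(1)]
          by (simp add: arm_width_def ennreal_plus del: atLeastAtMost_iff)
      qed
    qed
    also have "\<dots> = avg m h (?M (\<theta>, h)) + avg m h (?W (\<theta>, h)) + avg m h (\<lambda>s a. ?B (\<theta>, h))"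
      by (simp only: avg_add)
    also have "avg m h (\<lambda>s a. ?B (\<theta>, h)) = ?B (\<theta>, h)"
      using avg_const[OF r, of "\<lambda>s. ?B (\<theta>, h)"]
      by (simp add: sum_distrib_right[symmetric] sum_pmf_PS m_def)
    finally show "avg m (snd (\<theta>, h)) (?U (snd (\<theta>, h))) \<le>
      avg m (snd (\<theta>, h)) (?M (\<theta>, h)) + avg m (snd (\<theta>, h)) (?W (\<theta>, h)) + ?B (\<theta>, h)" by simp
  qed (use Ma Wa Ua Bm in \<open>simp_all\<close>)
  also have "\<dots> = (\<integral>\<^sup>+x. avg m (snd x) (?M x) \<partial>joint j) + (\<integral>\<^sup>+x. avg m (snd x) (?W x) \<partial>joint j) + ?P"
    using Ma Wa Bm by (simp add: nn_integral_add J)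
  finally have "(\<integral>\<^sup>+x. avg m (snd x) (?R x) \<partial>joint j) \<le> (\<integral>\<^sup>+x. avg m (snd x) (?W x) \<partial>joint j) + (?P + ?P)"
    using fin by (simp add: add.assoc ennreal_add_left_cancel_le)
  also have "\<dots> \<le> (\<integral>\<^sup>+x. avg m (snd x) (?W x) \<partial>joint j) +
     (ennreal (2 * CARD('s) * K * (j * N) * exp (- 2 * \<beta>\<^sup>2)) + ennreal (2 * CARD('s) * K * (j * N) * exp (- 2 * \<beta>\<^sup>2)))"
    unfolding m_def by (intro add_left_mono add_mono bad_prob assms)
  also have "\<dots> = (\<integral>\<^sup>+x. avg m (snd x) (?W x) \<partial>joint j) + ennreal (4 * CARD('s) * K * (j * N) * exp (- 2 * \<beta>\<^sup>2))"
    by (simp add: ennreal_plus[symmetric] del: ennreal_plus)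
  \<comment> \<open>Back to entry k of the complete run, since the widths of different pulls are to
    be added along one and the same history.\<close>
  also have "(\<integral>\<^sup>+x. avg m (snd x) (?W x) \<partial>joint j) =
     (\<integral>\<^sup>+x. ?W x (fst (snd x k)) (fst (snd (snd x k))) \<partial>joint J)"
    unfolding m_def k_def using prefix_arm_width
    by (intro nn_integral_joint_entry[symmetric] assms(2,3) Wm[unfolded m_def]) simp
  also have "(\<integral>\<^sup>+x. avg m (snd x) (?R x) \<partial>joint j) = (\<integral>\<^sup>+x. ?R x (fst (snd x k)) (fst (snd (snd x k))) \<partial>joint J)"
    unfolding m_def k_def
    by (intro nn_integral_joint_entry[symmetric] assms(2,3) measurable_regr) (simp add: prefix_fun_def)
  finally show ?thesis by (simp add: m_def)
qed

section \<open>Widths summed along a history\<close>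

lemma cnt_Suc: "cnt (Suc k) h s a = cnt k h s a + (if fst (h k) = s \<and> fst (snd (h k)) = a then 1 else 0)"
  by (simp add: cnt_eq)

lemma cnt_add_le: "cnt (m + n) h s a \<le> cnt m h s a + n"
  by (induction n) (auto simp: cnt_Suc)

text \<open>The right side is the increase from p to p + 1 of the potential min (p, 2 N) + 4 sqrt 2
  \<beta> sqrt p, where p is the current count and c the count at the start of the round. For p < 2
  N the first part pays the maximal width 1; for p \<ge> 2 N the lag bound gives p + 1 \<le> 2 c,
  whence the factor sqrt 2.\<close>

lemma width_le_potential:
  assumes "\<beta> \<ge> 0" "p < c + N"
  shows "width \<beta> c \<le> (min (real (Suc p)) (2 * N) - min (real p) (2 * N)) +
     4 * sqrt 2 * \<beta> * (sqrt (Suc p) - sqrt p)"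
proof (cases "p < 2 * N")
  case True
  have "0 \<le> 4 * sqrt 2 * \<beta> * (sqrt (Suc p) - sqrt p)" using assms by (intro mult_nonneg_nonneg) auto
  moreover have "width \<beta> c \<le> 1" by (simp add: width_def)
  moreover have "min (real (Suc p)) (2 * N) - min (real p) (2 * N) = 1" using True by (simp add: min_def)
  ultimately show ?thesis by linarith
next
  case False
  then have c: "Suc p \<le> 2 * c" "c \<noteq> 0" using assms N_pos by auto
  have "width \<beta> c \<le> 2 * \<beta> / sqrt c" using c by (simp add: width_def)
  also have "\<dots> = 2 * \<beta> * sqrt 2 / sqrt (2 * c)" by (simp add: real_sqrt_mult)
  also have "\<dots> \<le> 2 * \<beta> * sqrt 2 / sqrt (Suc p)"
    using c assms(1) by (intro divide_left_mono) auto
  also have "\<dots> = 2 * \<beta> * sqrt 2 * (1 / sqrt (real p + 1))" by (simp add: add.commute)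
  also have "\<dots> \<le> 2 * \<beta> * sqrt 2 * (2 * (sqrt (real p + 1) - sqrt p))"
    using assms(1) by (intro mult_left_mono inverse_sqrt_le_sqrt_diff) auto
  finally have "width \<beta> c \<le> 4 * sqrt 2 * \<beta> * (sqrt (Suc p) - sqrt p)"
    by (simp add: algebra_simps)
  moreover have "min (real (Suc p)) (2 * N) - min (real p) (2 * N) = 0" using False by (simp add: min_def)
  ultimately show ?thesis by linarith
qed

text \<open>Pathwise: each pull raises the potential of its own pair by at least the width charged
  for it and leaves the other pairs unchanged.\<close>

lemma sum_arm_width:
  assumes "\<beta> \<ge> 0"
  shows "(\<Sum>k<T. arm_width \<beta> (k div N * N) h (fst (h k)) (fst (snd (h k)))) \<le>
    (\<Sum>p\<in>arms. min (real (cnt T h (fst p) (snd p))) (2 * N) + 4 * sqrt 2 * \<beta> * sqrt (cnt T h (fst p) (snd p)))"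
proof (induction T)
  case 0
  then show ?case using assms by (simp add: sum_nonneg)
next
  case (Suc k)
  define G where "G x = min (real x) (2 * N) + 4 * sqrt 2 * \<beta> * sqrt x" for x :: nat
  define q where "q = (fst (h k), fst (snd (h k)))"
  have step: "(\<Sum>p\<in>arms. G (cnt k h (fst p) (snd p))) + arm_width \<beta> (k div N * N) h (fst (h k)) (fst (snd (h k)))
      \<le> (\<Sum>p\<in>arms. G (cnt (Suc k) h (fst p) (snd p)))"
  proof (cases "q \<in> arms")
    case True
    have other: "cnt (Suc k) h (fst p) (snd p) = cnt k h (fst p) (snd p)" if "p \<in> arms - {q}" for p
      using that by (auto simp: cnt_Suc q_def)
    have q: "cnt (Suc k) h (fst q) (snd q) = Suc (cnt k h (fst q) (snd q))" by (simp add: cnt_Suc q_def)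
    define p where "p = cnt k h (fst q) (snd q)"
    define c where "c = cnt (k div N * N) h (fst q) (snd q)"
    \<comment> \<open>Only k mod N entries lie between the start of the round and entry k.\<close>
    have "p \<le> c + k mod N" using cnt_add_le[of "k div N * N" "k mod N"] by (simp add: p_def c_def)
    then have "p < c + N" using N_pos by (meson add_less_cancel_left le_less_trans mod_less_divisor less_le_trans zero_less_one)
    then have "width \<beta> c \<le> G (Suc p) - G p"
      using width_le_potential[OF assms, of p c] by (simp add: G_def algebra_simps)
    moreover have "arm_width \<beta> (k div N * N) h (fst (h k)) (fst (snd (h k))) = width \<beta> c"
      using True by (simp add: arm_width_def c_def q_def arms_def)
    moreover have "(\<Sum>p\<in>arms. G (cnt (Suc k) h (fst p) (snd p))) = G (Suc p) + (\<Sum>p\<in>arms - {q}. G (cnt k h (fst p) (snd p)))"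
      using True by (subst sum.remove[of arms q]) (simp_all add: q p_def other)
    moreover have "(\<Sum>p\<in>arms. G (cnt k h (fst p) (snd p))) = G p + (\<Sum>p\<in>arms - {q}. G (cnt k h (fst p) (snd p)))"
      using True by (subst sum.remove[of arms q]) (simp_all add: p_def)
    ultimately show ?thesis by linarith
  next
    case False
    then have "arm_width \<beta> (k div N * N) h (fst (h k)) (fst (snd (h k))) = 0"
      by (auto simp: arm_width_def q_def arms_def)
    moreover have "cnt (Suc k) h (fst p) (snd p) = cnt k h (fst p) (snd p)" if "p \<in> arms" for p
      using that False by (auto simp: cnt_Suc q_def)
    ultimately show ?thesis by simp
  qed
  show ?case using Suc.IH step unfolding G_def by (simp add: lessThan_Suc)
qed

text \<open>Only an inequality, since an arbitrary history may contain arms outside 1..K.\<close>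

lemma sum_cnt_le: "(\<Sum>p\<in>arms. cnt T h (fst p) (snd p)) \<le> T"
proof -
  have "(\<Sum>p\<in>arms. cnt T h (fst p) (snd p)) = (\<Sum>k<T. \<Sum>p\<in>arms. if (fst (h k), fst (snd (h k))) = p then 1 else 0)"
    unfolding cnt_eq by (subst sum.swap) (auto intro!: sum.cong)
  also have "\<dots> \<le> (\<Sum>k<T. 1)" by (intro sum_mono) (simp add: sum.delta)
  finally show ?thesis by simp
qed

text \<open>The capped counts contribute 2 N per pair, which is the origin of the term 2SKN.
  Cauchy-Schwarz over the SK pairs turns the square roots of the counts into sqrt (SKT).\<close>

lemma sum_arm_width_le:
  assumes "\<beta> \<ge> 0"
  shows "(\<Sum>k<T. arm_width \<beta> (k div N * N) h (fst (h k)) (fst (snd (h k)))) \<le>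
    2 * CARD('s) * K * N + 4 * sqrt 2 * \<beta> * sqrt (CARD('s) * K * T)"
proof -
  let ?c = "\<lambda>p. real (cnt T h (fst p) (snd p))"
  have card: "card arms = CARD('s) * K" by (simp add: arms_def card_cartesian_product)
  have "(\<Sum>p\<in>arms. sqrt (?c p))\<^sup>2 \<le> (\<Sum>p\<in>arms. (sqrt (?c p))\<^sup>2) * card arms"
    by (rule sum_squared_le_sum_of_squares)
  also have "(\<Sum>p\<in>arms. (sqrt (?c p))\<^sup>2) = real (\<Sum>p\<in>arms. cnt T h (fst p) (snd p))" by simp
  also have "\<dots> * card arms \<le> real T * card arms"
    using sum_cnt_le by (intro mult_right_mono) (simp_all only: of_nat_le_iff of_nat_0_le_iff)
  finally have sq: "(\<Sum>p\<in>arms. sqrt (?c p)) \<le> sqrt (CARD('s) * K * T)"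
    by (intro real_le_rsqrt) (simp add: card mult.commute mult.left_commute)
  have "(\<Sum>p\<in>arms. min (?c p) (2 * N) + 4 * sqrt 2 * \<beta> * sqrt (?c p)) \<le>
    (\<Sum>p\<in>arms. 2 * real N) + 4 * sqrt 2 * \<beta> * (\<Sum>p\<in>arms. sqrt (?c p))"
    unfolding sum.distrib sum_distrib_left by (intro add_mono sum_mono) auto
  also have "\<dots> \<le> (\<Sum>p\<in>arms. 2 * real N) + 4 * sqrt 2 * \<beta> * sqrt (CARD('s) * K * T)"
    using assms by (intro add_left_mono mult_left_mono sq) auto
  also have "(\<Sum>p\<in>arms. 2 * real N) = 2 * CARD('s) * K * N" by (simp add: card)
  finally show ?thesis using sum_arm_width[OF assms, of h T] by linarith
qed

section \<open>Total regret\<close>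

lemma measurable_regr_entry:
  "(\<lambda>x. ennreal (regr (fst x) (fst (snd x k)) (fst (snd (snd x k))))) \<in> borel_measurable (prior \<Otimes>\<^sub>M histM)"
  by (rule measurable_entry[OF measurable_regr])

lemma measurable_width_entry:
  "(\<lambda>x. ennreal (arm_width \<beta> m (snd x) (fst (snd x k)) (fst (snd (snd x k))))) \<in> borel_measurable (prior \<Otimes>\<^sub>M histM)"
  by (rule measurable_entry) measurable

lemma joint_const_le: "(\<integral>\<^sup>+x. c \<partial>joint j) \<le> (c::ennreal)"
  using mult_left_mono[OF joint_le_1, of c j] by simp

lemma total_regret:
  assumes J: "J \<ge> 1"
  defines "T \<equiv> J * N"
  shows "(\<integral>\<^sup>+x. (\<Sum>k<T. ennreal (regr (fst x) (fst (snd x k)) (fst (snd (snd x k))))) \<partial>joint J) \<le>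
    ennreal (2 * (CARD('s) * K) * N + 4 * sqrt 2 * sqrt (ln T) * sqrt (CARD('s) * K * T) + 4 * (CARD('s) * K))"
proof -
  \<comment> \<open>This choice makes exp (- 2 \<beta>^2) equal to 1 / T^2. Since at most T pulls
    precede a round, the failure term of each pull is at most 4 M / T, and the T pulls together
    contribute 4 M.\<close>
  define \<beta> where "\<beta> = sqrt (ln T)"
  define M where "M = CARD('s) * K"
  let ?R = "\<lambda>k x. ennreal (regr (fst x) (fst (snd x k)) (fst (snd (snd x k))))"
  let ?W = "\<lambda>k x. arm_width \<beta> (k div N * N) (snd x) (fst (snd x k)) (fst (snd (snd x k)))"
  have T: "T \<ge> 1" using mult_le_mono[OF J N_pos] by (simp add: T_def)
  have \<beta>: "\<beta> \<ge> 0" using T by (simp add: \<beta>_def)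
  have "exp (- 2 * \<beta>\<^sup>2) = 1 / (real T)\<^sup>2"
  proof -
    have "\<beta>\<^sup>2 = ln T" using T by (simp add: \<beta>_def)
    then have "exp (- 2 * \<beta>\<^sup>2) = inverse (exp (ln T) ^ 2)"
      using exp_minus[of "2 * ln T"] exp_double[of "ln T"] by simp
    then show ?thesis using T by (simp add: divide_inverse)
  qed
  note ex = this
  have J_meas: "borel_measurable (joint J) = borel_measurable (prior \<Otimes>\<^sub>M histM)"
    by (rule measurable_cong_sets[OF sets_joint refl])
  have each: "(\<integral>\<^sup>+x. ?R k x \<partial>joint J) \<le> (\<integral>\<^sup>+x. ennreal (?W k x) \<partial>joint J) + ennreal (4 * M / T)" if "k < T" for k
  proof -
    have k: "k div N < J" "k mod N < N" "k div N * N + k mod N = k"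
      using that N_pos by (auto simp: T_def less_mult_imp_div_less)
    have "real (k div N * N) * (1 / (real T)\<^sup>2) \<le> T * (1 / (real T)\<^sup>2)"
    proof (intro mult_right_mono)
      have "k div N * N \<le> T" using that by (meson div_times_less_eq_dividend less_imp_le order_trans)
      then show "real (k div N * N) \<le> real T" by (simp only: of_nat_le_iff)
    qed simp
    also have "\<dots> = 1 / T" using T by (simp add: power2_eq_square)
    finally have "real M * (real (k div N * N) * (1 / (real T)\<^sup>2)) \<le> M * (1 / T)"
      by (intro mult_left_mono) auto
    then have "4 * CARD('s) * K * (k div N * N) * exp (- 2 * \<beta>\<^sup>2) \<le> 4 * M / T"
      unfolding ex by (simp add: M_def mult.assoc)
    from ennreal_leI[OF this] round_regret[OF \<beta> k(1,2)] show ?thesis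
      unfolding k(3) by (meson add_left_mono order_trans)
  qed
  have "(\<integral>\<^sup>+x. (\<Sum>k<T. ?R k x) \<partial>joint J) = (\<Sum>k<T. \<integral>\<^sup>+x. ?R k x \<partial>joint J)"
    by (rule nn_integral_sum) (simp add: J_meas measurable_regr_entry)
  also have "\<dots> \<le> (\<Sum>k<T. (\<integral>\<^sup>+x. ennreal (?W k x) \<partial>joint J) + ennreal (4 * M / T))"
    by (intro sum_mono each) simp
  also have "\<dots> = (\<integral>\<^sup>+x. (\<Sum>k<T. ennreal (?W k x)) \<partial>joint J) + (\<Sum>k<T. ennreal (4 * M / T))"
    unfolding sum.distrib by (subst nn_integral_sum) (simp_all add: J_meas measurable_width_entry)
  also have "(\<Sum>k<T. ennreal (4 * M / T)) = ennreal (4 * M)"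
    using T by (simp add: ennreal_of_nat_eq_real_of_nat ennreal_mult'[symmetric])
  also have "(\<integral>\<^sup>+x. (\<Sum>k<T. ennreal (?W k x)) \<partial>joint J) \<le>
      (\<integral>\<^sup>+x. ennreal (2 * M * N + 4 * sqrt 2 * \<beta> * sqrt (M * T)) \<partial>joint J)"
  proof (intro nn_integral_mono)
    fix x
    have "(\<Sum>k<T. ennreal (?W k x)) = ennreal (\<Sum>k<T. ?W k x)"
      using width_nonneg[OF \<beta>] by (intro sum_ennreal) (simp add: arm_width_def)
    also have "\<dots> \<le> ennreal (2 * M * N + 4 * sqrt 2 * \<beta> * sqrt (M * T))"
      using sum_arm_width_le[OF \<beta>, where T=T and h="snd x"] by (intro ennreal_leI) (simp add: M_def mult.assoc)
    finally show "(\<Sum>k<T. ennreal (?W k x)) \<le> ennreal (2 * M * N + 4 * sqrt 2 * \<beta> * sqrt (M * T))" .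
  qed
  also have "\<dots> \<le> ennreal (2 * M * N + 4 * sqrt 2 * \<beta> * sqrt (M * T))"
    by (rule joint_const_le)
  also have "ennreal (2 * M * N + 4 * sqrt 2 * \<beta> * sqrt (M * T)) + ennreal (4 * M) =
     ennreal (2 * M * N + 4 * sqrt 2 * \<beta> * sqrt (M * T) + 4 * M)"
    using \<beta> by (subst ennreal_plus) auto
  finally show ?thesis by (simp add: M_def \<beta>_def)
qed

text \<open>The bounds on \<open>regr\<close> concern arms in range. The indicator of the opposite
  has policy average 0, because the greedy choice stays in range.\<close>

lemma AE_arms:
  assumes g: "good \<theta>"
  shows "AE h in run \<theta> J. \<forall>k<J * N. fst (snd (h k)) \<in> {1..K}"
proof -
  have "AE h in run \<theta> J. fst (snd (h k)) \<in> {1..K}" if "k < J * N" for k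
  proof -
    have k: "k div N < J" "k mod N < N" "k div N * N + k mod N = k"
      using that N_pos by (auto simp: less_mult_imp_div_less)
    let ?F = "\<lambda>h s a. of_bool (a \<notin> {1..K}) :: ennreal"
    have "(\<integral>\<^sup>+h. ?F h (fst (h k)) (fst (snd (h k))) \<partial>run \<theta> J) = (\<integral>\<^sup>+h. avg (k div N * N) h (?F h) \<partial>run \<theta> (k div N))"
      using nn_integral_run_entry[OF g, of ?F "k div N" J "k mod N"] k by (simp add: prefix_fun_def)
    also have "\<dots> = 0" using act_mem by (simp add: avg_def)
    finally have z: "(\<integral>\<^sup>+h. of_bool (fst (snd (h k)) \<notin> {1..K}) \<partial>run \<theta> J) = (0::ennreal)" .
    have "(\<lambda>h. of_bool (fst (snd (h k)) \<notin> {1..K}) :: ennreal) \<in> borel_measurable (run \<theta> J)"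
      unfolding measurable_run_cong[OF g] by (rule measurable_compose[OF measurable_hist_obs(2)]) simp
    from z[unfolded nn_integral_0_iff_AE[OF this]] show ?thesis by (rule eventually_mono) (simp split: if_splits)
  qed
  then have "AE h in run \<theta> J. \<forall>k\<in>{..<J * N}. fst (snd (h k)) \<in> {1..K}"
    by (intro AE_finite_allI) auto
  then show ?thesis by (rule eventually_mono) auto
qed

abbreviation "BR \<equiv> bayes_regret_TS PS K N \<nu> b Tf \<eta> A Q"

lemma sys_regret_eq: "sys_regret K \<nu> b Tf \<eta> A \<theta> n h = (\<Sum>k<n. regr \<theta> (fst (h k)) (fst (snd (h k))))"
  unfolding sys_regret_def regr_def opt_eq ..

text \<open>Nonnegativity of the regret, valid almost surely at both levels, allows the passage from
  the Bochner integrals of the definition to \<open>joint\<close>. The crude bound of 1 per pull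
  serves horizons shorter than SK.\<close>

lemma BR_bounds:
  shows BR_nonneg: "0 \<le> BR J"
    and BR_le_joint: "ennreal (BR J) \<le>
      (\<integral>\<^sup>+x. (\<Sum>k<J * N. ennreal (regr (fst x) (fst (snd x k)) (fst (snd (snd x k))))) \<partial>joint J)"
    and BR_le_T: "BR J \<le> J * N"
proof -
  let ?S = "\<lambda>\<theta> h. \<Sum>k<J * N. regr \<theta> (fst (h k)) (fst (snd (h k)))"
  let ?E = "\<lambda>\<theta> h. \<Sum>k<J * N. ennreal (regr \<theta> (fst (h k)) (fst (snd (h k))))"
  have eq: "BR J = (\<integral>\<theta>. \<integral>h. ?S \<theta> h \<partial>run \<theta> J \<partial>prior)"
    unfolding bayes_regret_TS_def sys_regret_eq ..
  have range: "AE h in run \<theta> J. \<forall>k<J * N. 0 \<le> regr \<theta> (fst (h k)) (fst (snd (h k))) \<and> regr \<theta> (fst (h k)) (fst (snd (h k))) \<le> 1"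
    if g: "good \<theta>" for \<theta>
    using AE_arms[OF g] by (rule eventually_mono) (use regr_good[OF g] in blast)
  have nonneg: "AE h in run \<theta> J. 0 \<le> ?S \<theta> h" if "good \<theta>" for \<theta>
    using range[OF that] by (rule eventually_mono) (auto intro: sum_nonneg)
  have inner: "AE \<theta> in prior. 0 \<le> (\<integral>h. ?S \<theta> h \<partial>run \<theta> J)"
    using AE_prior_good by (rule eventually_mono) (rule integral_nonneg_AE, rule nonneg)
  show "0 \<le> BR J" unfolding eq by (rule integral_nonneg_AE[OF inner])
  have "ennreal (BR J) \<le> (\<integral>\<^sup>+\<theta>. ennreal (\<integral>h. ?S \<theta> h \<partial>run \<theta> J) \<partial>prior)"
    unfolding eq by (rule ennreal_integral_le_nn_integral[OF inner])
  also have "\<dots> \<le> (\<integral>\<^sup>+\<theta>. \<integral>\<^sup>+h. ?E \<theta> h \<partial>run \<theta> J \<partial>prior)"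
  proof (rule nn_integral_mono_AE, use AE_prior_good in eventually_elim)
    fix \<theta> assume g: "good \<theta>"
    have "ennreal (\<integral>h. ?S \<theta> h \<partial>run \<theta> J) \<le> (\<integral>\<^sup>+h. ennreal (?S \<theta> h) \<partial>run \<theta> J)"
      by (rule ennreal_integral_le_nn_integral[OF nonneg[OF g]])
    also have "\<dots> = (\<integral>\<^sup>+h. ?E \<theta> h \<partial>run \<theta> J)"
      by (rule nn_integral_cong_AE, rule eventually_mono[OF range[OF g]]) (subst sum_ennreal, auto)
    finally show "ennreal (\<integral>h. ?S \<theta> h \<partial>run \<theta> J) \<le> (\<integral>\<^sup>+h. ?E \<theta> h \<partial>run \<theta> J)" .
  qed
  finally have le: "ennreal (BR J) \<le> (\<integral>\<^sup>+\<theta>. \<integral>\<^sup>+h. ?E \<theta> h \<partial>run \<theta> J \<partial>prior)" .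
  have meas: "(\<lambda>x. ?E (fst x) (snd x)) \<in> borel_measurable (prior \<Otimes>\<^sub>M histM)"
    by (intro borel_measurable_sum measurable_regr_entry)
  show "ennreal (BR J) \<le> (\<integral>\<^sup>+x. ?E (fst x) (snd x) \<partial>joint J)"
    using le by (simp add: nn_integral_joint[OF meas])
  have "(\<integral>\<^sup>+\<theta>. \<integral>\<^sup>+h. ?E \<theta> h \<partial>run \<theta> J \<partial>prior) \<le> (\<integral>\<^sup>+\<theta>. ennreal (J * N) \<partial>prior)"
  proof (rule nn_integral_mono_AE, use AE_prior_good in eventually_elim)
    fix \<theta> assume g: "good \<theta>"
    have "(\<integral>\<^sup>+h. ?E \<theta> h \<partial>run \<theta> J) \<le> (\<integral>\<^sup>+h. ennreal (J * N) \<partial>run \<theta> J)"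
    proof (rule nn_integral_mono_AE, use range[OF g] in eventually_elim)
      fix h assume "\<forall>k<J * N. 0 \<le> regr \<theta> (fst (h k)) (fst (snd (h k))) \<and> regr \<theta> (fst (h k)) (fst (snd (h k))) \<le> 1"
      then have "?E \<theta> h \<le> (\<Sum>k<J * N. 1)" by (intro sum_mono) (simp add: ennreal_le_1)
      then show "?E \<theta> h \<le> ennreal (J * N)" by (simp add: ennreal_of_nat_eq_real_of_nat)
    qed
    also have "\<dots> = ennreal (J * N)"
      using prob_space.emeasure_space_1[OF prob_space_run[OF g], of J] by simp
    finally show "(\<integral>\<^sup>+h. ?E \<theta> h \<partial>run \<theta> J) \<le> ennreal (J * N)" .
  qed
  also have "\<dots> = ennreal (J * N)"
    using prob_space.emeasure_space_1[OF prob_space_prior] by simp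
  finally have "ennreal (BR J) \<le> ennreal (J * N)" using le by (rule order_trans[rotated])
  then show "BR J \<le> J * N" by simp
qed

lemma BR_finite_time:
  assumes J: "J \<ge> 1"
  shows "BR J \<le> 2 * real CARD('s) * real K * real N
    + 4 * sqrt ((2 + 6 * ln (real (J * N))) * real CARD('s) * real K * real N * real (J * N))"
proof -
  define M where "M = real (CARD('s) * K)"
  define T where "T = real (J * N)"
  have M: "M \<ge> 1"
  proof -
    have "CARD('s) * K \<noteq> 0" using K_pos by simp
    then show ?thesis unfolding M_def by linarith
  qed
  have N: "real N \<ge> 1" using N_pos by simp
  have T: "T \<ge> 1"
  proof -
    have "J * N \<noteq> 0" using J N_pos by simp
    then show ?thesis unfolding T_def by linarith
  qed
  have "BR J \<le> 2 * M * N + 4 * sqrt ((2 + 6 * ln T) * (M * N * T))"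
  \<comment> \<open>The lower-order term 4 M is absorbed only for M \<le> T; for T < M the crude
    bound T is already below 2 M N.\<close>
  proof (cases "M \<le> T")
    case True
    have "ennreal (BR J) \<le> ennreal (2 * M * N + 4 * sqrt 2 * sqrt (ln T) * sqrt (M * T) + 4 * M)"
      using order_trans[OF BR_le_joint total_regret[OF J]] by (simp add: M_def T_def)
    then have "BR J \<le> 2 * M * N + 4 * sqrt 2 * sqrt (ln T) * sqrt (M * T) + 4 * M"
      using M T N by (subst (asm) ennreal_le_iff) (auto intro!: add_nonneg_nonneg)
    also have "\<dots> \<le> 2 * M * N + 4 * sqrt ((2 + 6 * ln T) * (M * N * T))"
      using M N T True by (intro regret_arithmetic) auto
    finally show ?thesis .
  next
    case False
    have "BR J \<le> T" using BR_le_T by (simp add: T_def)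
    also have "\<dots> \<le> M * 1" using False by simp
    also have "\<dots> \<le> M * (2 * N)" using M N by (intro mult_left_mono) auto
    also have "\<dots> = 2 * M * N" by simp
    also have "\<dots> \<le> 2 * M * N + 4 * sqrt ((2 + 6 * ln T) * (M * N * T))"
      using M N T by simp
    finally show ?thesis .
  qed
  then show ?thesis by (simp add: M_def T_def mult.assoc mult.commute mult.left_commute)
qed

text \<open>The limit is J to infinity with S, K and N fixed, so the constant may depend on them and
  absorbs both the additive term and the factor sqrt N.\<close>

lemma BR_bigo: "BR \<in> O(\<lambda>J. sqrt (real K * real CARD('s) * real (J * N) * ln (real (J * N))))"
proof -
  define M where "M = real (CARD('s) * K)"
  have M: "M \<ge> 1"
  proof -
    have "CARD('s) * K \<noteq> 0" using K_pos by simp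
    then show ?thesis unfolding M_def by linarith
  qed
  have N: "real N \<ge> 1" using N_pos by simp
  show ?thesis
  \<comment> \<open>From J = 3 on, T is at least 3 > e and ln T \<ge> 1. Hence 2 + 6 ln T \<le> 8 ln
    T, and the rate \<open>X\<close> is at least 1, so the additive term can be multiplied by
    it.\<close>
  proof (rule bigoI[where c="2 * M * N + 4 * sqrt (8 * N)"], rule eventually_sequentiallyI[of 3])
    fix J :: nat assume J: "3 \<le> J"
    define T where "T = real (J * N)"
    define X where "X = sqrt (M * T * ln T)"
    have "real J * 1 \<le> real J * real N" using N by (intro mult_left_mono) auto
    then have T: "T \<ge> 3" using J unfolding T_def of_nat_mult by linarith
    have "1 \<le> ln T" using T exp_le by (subst ln_ge_iff) auto
    note L = this
    have "1 * 1 * 1 \<le> M * T * ln T" using M T L by (intro mult_mono) auto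
    then have X: "1 \<le> X" unfolding X_def by (intro real_le_rsqrt) simp
    have "norm (BR J) = BR J" using BR_nonneg by simp
    also have "\<dots> \<le> 2 * M * N + 4 * sqrt ((2 + 6 * ln T) * (M * N * T))"
      using BR_finite_time[of J] J by (simp add: M_def T_def mult.assoc mult.commute mult.left_commute)
    also have "\<dots> \<le> 2 * M * N * X + 4 * sqrt ((8 * ln T) * (M * N * T))"
      using X M N L T by (intro add_mono mult_left_mono real_sqrt_le_mono mult_right_mono) auto
    also have "(8 * ln T) * (M * N * T) = (8 * N) * (M * T * ln T)" by (simp add: mult_ac)
    also have "sqrt \<dots> = sqrt (8 * N) * X" by (simp add: X_def real_sqrt_mult)
    also have "2 * M * N * X + 4 * (sqrt (8 * N) * X) = (2 * M * N + 4 * sqrt (8 * N)) * X"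
      by (simp add: distrib_right)
    also have "X = norm (sqrt (real K * real CARD('s) * real (J * N) * ln (real (J * N))))"
      using T L M by (simp add: X_def M_def T_def mult_ac)
    finally show "norm (BR J) \<le> (2 * M * N + 4 * sqrt (8 * N)) *
       norm (sqrt (real K * real CARD('s) * real (J * N) * ln (real (J * N))))" .
  qed
qed

end

theorem theorem1:
  fixes PS :: "'s::finite pmf" and K N :: nat and \<nu> :: "real measure"
    and b Tf \<eta> A :: "real \<Rightarrow> real" and \<Theta> :: "real set"
    and Q :: "'s \<Rightarrow> nat \<Rightarrow> real measure"
  assumes ctx_pos: "\<forall>s. pmf PS s > 0"
    and K_pos: "K \<ge> 1" and N_pos: "N \<ge> 1"
    and base_sets: "sets \<nu> = sets borel"
    and rewards_unit: "emeasure \<nu> (UNIV - {0..1}) = 0"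
    and b_meas: "b \<in> borel_measurable borel" and b_nonneg: "\<forall>r. b r \<ge> 0"
    and T_meas: "Tf \<in> borel_measurable borel"
    and eta_meas: "\<eta> \<in> borel_measurable borel"
    and A_meas: "A \<in> borel_measurable borel"
    and Theta_open: "open \<Theta>"
    and normalized: "\<forall>v\<in>\<Theta>. (\<integral>\<^sup>+r. ennreal (b r * exp (\<eta> v * Tf r - A v)) \<partial>\<nu>) = 1"
    and A_twice_diff: "\<exists>A' A''. \<forall>v\<in>\<Theta>. (A has_real_derivative A' v) (at v)
                                         \<and> (A' has_real_derivative A'' v) (at v)"
    and prior: "\<forall>s a. prob_space (Q s a) \<and> sets (Q s a) = sets borel \<and> (AE v in Q s a. v \<in> \<Theta>)"
  shows "(\<forall>J\<ge>1. bayes_regret_TS PS K N \<nu> b Tf \<eta> A Q J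
            \<le> 2 * real CARD('s) * real K * real N
              + 4 * sqrt ((2 + 6 * ln (real (J * N))) * real CARD('s) * real K * real N * real (J * N)))
       \<and> (\<lambda>J. bayes_regret_TS PS K N \<nu> b Tf \<eta> A Q J)
            \<in> O(\<lambda>J. sqrt (real K * real CARD('s) * real (J * N) * ln (real (J * N))))"
proof -
  obtain v0 where "v0 \<in> \<Theta>"
  proof -
    interpret prob_space "Q undefined 0" using prior by blast
    \<comment> \<open>A probability measure cannot be concentrated on the empty set, which supplies
      the reference parameter.\<close>
    have "\<Theta> \<noteq> {}"
    proof
      assume "\<Theta> = {}"
      have "AE v in Q undefined 0. v \<in> \<Theta>" using prior by blast
      then show False unfolding \<open>\<Theta> = {}\<close> by simp
    qed
    then show thesis using that by blast
  qed
  interpret ts_bandit PS K N \<nu> b Tf \<eta> A \<Theta> Q v0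
  proof (rule ts_bandit.intro)
    show "b r \<ge> 0" for r using b_nonneg by blast
    show "(\<integral>\<^sup>+r. ennreal (b r * exp (\<eta> v * Tf r - A v)) \<partial>\<nu>) = 1" if "v \<in> \<Theta>" for v
      using normalized that by blast
    show "prob_space (Q s a)" "sets (Q s a) = sets borel" "AE v in Q s a. v \<in> \<Theta>" for s a
      using prior by blast+
  qed fact+
  show ?thesis using BR_finite_time BR_bigo by (intro conjI allI impI)
qed

end
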